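(* Let $(\mathcal{L}_\hbar,\mathcal{I},B)$ be an asymptotic lattice with $B\subset\mathbb{R}^2$, let $k_\hbar$ be a good labelling of it, let $B_0\Subset B$ be open and $c\in B_0$. For each $\hbar\in\mathcal{I}$ small enough, let $\lambda_{0,0},\lambda_{1,0},\lambda_{0,1}\in\mathcal{L}_\hbar$ be points produced by the labelling algorithm (described in the context), and set $$\vec z_1=k_\hbar(\lambda_{1,0})-k_\hbar(\lambda_{0,0}),\qquad\vec z_2=k_\hbar(\lambda_{0,1})-k_\hbar(\lambda_{0,0}).$$ Then there exists $\hbar_0^{[4]}>0$ such that $\vec z_1$ and $\vec z_2$ form a $\mathbb{Z}$-basis of $\mathbb{Z}^2$ for any $\hbar\in\mathcal{I}$ with $\hbar\le\hbar_0^{[4]}$.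
   Context: Asymptotic lattice: $B\subset\mathbb{R}^2$ simply connected bounded open, $\mathcal{I}\subset(0,\infty)$ accumulating at $0$, $\mathcal{L}_\hbar\subset B$ discrete for $\hbar\in\mathcal{I}$. $(\mathcal{L}_\hbar,\mathcal{I},B)$ is an asymptotic lattice if (1) for some $\hbar_0,\epsilon_0>0,N_0\ge1$, distinct points of $\mathcal{L}_\hbar$ are at distance $\ge\epsilon_0\hbar^{N_0}$ for $\hbar\in\mathcal{I}\cap(0,\hbar_0]$; (2) there are a bounded open $U\subset\mathbb{R}^2$ and smooth $G_\hbar:U\to\mathbb{R}^2$ with expansion $G_\hbar=G_0+\hbar G_1+\cdots$ in the $C^\infty(U)$ topology, $G_0$ an orientation preserving diffeomorphism from $U$ onto a neighborhood of $\overline B$, and constants $(C_N)_{N\in\mathbb{N}}$ such that for all $\hbar\in\mathcal{I}$: (a) each $\lambda\in\mathcal{L}_\hbar$ admits $k\in\mathbb{Z}^2$ with $\hbar k\in U$ and $\|\lambda-G_\hbar(\hbar k)\|\le C_N\hbar^N$ for all $N\in\mathbb{N}$ $( * )$; (b) for every open $\tilde U_0\Subset G_0^{-1}(B)$ there is $\tilde\hbar_0>0$ such that for $\hbar\in\mathcal{I}\cap(0,\tilde\hbar_0]$ and $k\in\mathbb{Z}^2$ with $\hbar k\in\tilde U_0$ there is $\lambda\in\mathcal{L}_\hbar$ with $( * )$. $(G_\hbar,U)$ is an asymptotic chart. For small $\hbar$ the integer vector $k_\hbar(\lambda)$ in $( * )$ is unique, and the injective map $k_\hbar:\mathcal{L}_\hbar\to\mathbb{Z}^2$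 is called a good labelling (associated with $G_\hbar$). $A\Subset B$ means $\overline A$ is compact and contained in $B$. Labelling algorithm (the part defining $\lambda_{0,0},\lambda_{1,0},\lambda_{0,1}$), run for a fixed $\hbar$. "Choose a closest point to $p$" means: choose a point of $\mathcal{L}_\hbar$, among those not already labelled, minimizing the Euclidean distance to $p$. (i) Choose a closest point to $c$ and label it $(0,0)$, i.e. call it $\lambda_{0,0}$. (ii) Choose a closest point to $\lambda_{0,0}$ in $\mathcal{L}_\hbar\setminus\{\lambda_{0,0}\}$ and call it $\lambda_{1,0}$. (iii) Inductively, for $n\ge2$, let $\lambda_{n,0}$ be a closest point to $\lambda_{n-1,0}+(\lambda_{n-1,0}-\lambda_{n-2,0})$, until the next point lies outside of $B_0$; label $\lambda_{n,0}$ for negative $n$ in the same way, starting from a closest point to $2\lambda_{0,0}-\lambda_{1,0}$, labelled $(-1,0)$. (iv) Choose a closest point to $\lambda_{0,0}$ not already labelled and call it $\lambda_{0,1}$.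
   Formalization: The expansion of G_ħ in the C^∞(U) topology is taken with remainder bounds uniform on all of U, not only on compact subsets; with compact-subset control alone, labels ħk near the boundary of U can produce spurious lattice points near c and the claim fails. *)

theory Defs
  imports "HOL-Analysis.Analysis"
begin

section \<open>Smooth maps\<close>

text \<open>Iterated partial derivatives. On an open set, their values depend only on the values of
  \<open>f\<close> on that set, so maps defined on an open \<open>U\<close> are represented by total functions.\<close>

primrec partials :: "'n list \<Rightarrow> (real^'n \<Rightarrow> 'b::real_normed_vector) \<Rightarrow> real^'n \<Rightarrow> 'b" where
  "partials [] f = f"
| "partials (i # is) f = (\<lambda>x. frechet_derivative (partials is f) (at x) (axis i 1))"

text \<open>For open \<open>U\<close>: all iterated partial derivatives exist and are differentiable, hence
  continuous, on \<open>U\<close>; this is the class of infinitely differentiable maps.\<close>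

definition smooth_on :: "(real^'n) set \<Rightarrow> (real^'n \<Rightarrow> 'b::real_normed_vector) \<Rightarrow> bool" where
  "smooth_on U f \<longleftrightarrow> (\<forall>is. \<forall>x\<in>U. partials is f differentiable (at x))"

definition oriented_diffeomorphism :: "(real^'n) set \<Rightarrow> (real^'n) set \<Rightarrow> (real^'n \<Rightarrow> real^'n) \<Rightarrow> bool"
  where
  "oriented_diffeomorphism U V f \<longleftrightarrow>
     open U \<and> open V \<and> bij_betw f U V \<and> smooth_on U f \<and> smooth_on V (inv_into U f) \<and>
     (\<forall>x\<in>U. det (jacobian f (at x)) > 0)"

text \<open>\<open>G\<^sub>h = g\<^sub>0 + h g\<^sub>1 + h\<^sup>2 g\<^sub>2 + \<dots>\<close> as \<open>h \<rightarrow> 0\<close> in \<open>I\<close>, in the \<open>C\<^sup>\<infinity>(U)\<close> topology. The seminorms are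
  the suprema over all of \<open>U\<close> of the partial derivatives. Control on compact subsets of \<open>U\<close> alone
  would leave \<open>G\<^sub>h\<close> unconstrained near the boundary of \<open>U\<close>, so that integer vectors \<open>k\<close> with \<open>h k\<close>
  close to that boundary could label spurious points anywhere in \<open>B\<close>.\<close>

definition smooth_expansion ::
  "real set \<Rightarrow> (real^'n) set \<Rightarrow> (real \<Rightarrow> real^'n \<Rightarrow> real^'n) \<Rightarrow> (nat \<Rightarrow> real^'n \<Rightarrow> real^'n) \<Rightarrow> bool"
  where
  "smooth_expansion I U G g \<longleftrightarrow>
     (\<forall>h\<in>I. smooth_on U (G h)) \<and> (\<forall>j. smooth_on U (g j)) \<and>
     (\<forall>N is. \<exists>K. \<forall>\<^sub>F h in at 0 within I. \<forall>x\<in>U.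
        norm (partials is (\<lambda>y. G h y - (\<Sum>j<N. h ^ j *\<^sub>R g j y)) x) \<le> K * h ^ N)"


section \<open>Asymptotic lattices and good labellings\<close>

definition compactly_contained :: "'a::topological_space set \<Rightarrow> 'a set \<Rightarrow> bool" where
  "compactly_contained A B \<longleftrightarrow> compact (closure A) \<and> closure A \<subseteq> B"

definition scaled :: "real \<Rightarrow> int^2 \<Rightarrow> real^2" where
  "scaled h k = (\<chi> i. h * real_of_int (k $ i))"

definition label_estimate ::
  "(real \<Rightarrow> real^2 \<Rightarrow> real^2) \<Rightarrow> (nat \<Rightarrow> real) \<Rightarrow> real \<Rightarrow> real^2 \<Rightarrow> int^2 \<Rightarrow> bool" where
  "label_estimate G C h l k \<longleftrightarrow> (\<forall>N. norm (l - G h (scaled h k)) \<le> C N * h ^ N)"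

text \<open>The constants \<open>C\<close> are a parameter because a good labelling refers to the same
  constants as its chart.\<close>

definition asymptotic_chart ::
  "(real \<Rightarrow> (real^2) set) \<Rightarrow> real set \<Rightarrow> (real^2) set \<Rightarrow>
   (real \<Rightarrow> real^2 \<Rightarrow> real^2) \<Rightarrow> (real^2) set \<Rightarrow> (nat \<Rightarrow> real) \<Rightarrow> bool" where
  "asymptotic_chart L I B G U C \<longleftrightarrow>
     bounded U \<and> open U \<and>
     (\<exists>g. smooth_expansion I U G g \<and>
        (\<exists>V. oriented_diffeomorphism U V (g 0) \<and> closure B \<subseteq> V) \<and>
        (\<forall>h\<in>I. \<forall>l\<in>L h. \<exists>k. scaled h k \<in> U \<and> label_estimate G C h l k) \<and>
        (\<forall>U0. open U0 \<and> compactly_contained U0 {x\<in>U. g 0 x \<in> B} \<longrightarrow>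
           (\<exists>h0>0. \<forall>h\<in>I. h \<le> h0 \<longrightarrow>
              (\<forall>k. scaled h k \<in> U0 \<longrightarrow> (\<exists>l\<in>L h. label_estimate G C h l k)))))"

definition asymptotic_lattice :: "(real \<Rightarrow> (real^2) set) \<Rightarrow> real set \<Rightarrow> (real^2) set \<Rightarrow> bool" where
  "asymptotic_lattice L I B \<longleftrightarrow>
     simply_connected B \<and> bounded B \<and> open B \<and>
     I \<subseteq> {0<..} \<and> 0 islimpt I \<and>
     (\<forall>h\<in>I. L h \<subseteq> B \<and> discrete (L h)) \<and>
     (\<exists>h0>0. \<exists>\<epsilon>>0. \<exists>N\<ge>1. \<forall>h\<in>I. h \<le> h0 \<longrightarrow>
        (\<forall>x\<in>L h. \<forall>y\<in>L h. x \<noteq> y \<longrightarrow> dist x y \<ge> \<epsilon> * h ^ N)) \<and>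
     (\<exists>G U C. asymptotic_chart L I B G U C)"

text \<open>A good labelling is only meaningful for small \<open>h\<close>; there the estimate determines
  \<open>k h l\<close> uniquely.\<close>

definition good_labelling ::
  "(real \<Rightarrow> (real^2) set) \<Rightarrow> real set \<Rightarrow> (real^2) set \<Rightarrow> (real \<Rightarrow> real^2 \<Rightarrow> int^2) \<Rightarrow> bool" where
  "good_labelling L I B k \<longleftrightarrow>
     (\<exists>G U C. asymptotic_chart L I B G U C \<and>
        (\<exists>h0>0. \<forall>h\<in>I. h \<le> h0 \<longrightarrow> inj_on (k h) (L h) \<and>
           (\<forall>l\<in>L h. scaled h (k h l) \<in> U \<and> label_estimate G C h l (k h l))))"


section \<open>The labelling algorithm\<close>

definition closest_unlabelled :: "(real^2) set \<Rightarrow> (real^2) set \<Rightarrow> real^2 \<Rightarrow> real^2 \<Rightarrow> bool" where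
  "closest_unlabelled S A p q \<longleftrightarrow> is_arg_min (\<lambda>x. dist x p) (\<lambda>x. x \<in> S - A) q"

text \<open>A run on the point set \<open>S\<close>: \<open>p n\<close> is the point labelled \<open>(n, 0)\<close>, for \<open>- b \<le> n \<le> a\<close>. The
  nonnegative labels are assigned first, in increasing order, then the negative ones in decreasing
  order, each chain ending when the chosen next point lies outside \<open>B0\<close>; that point is not
  labelled. The point \<open>p01\<close> is the one labelled \<open>(0, 1)\<close>.\<close>

definition labelling_run ::
  "(real^2) set \<Rightarrow> (real^2) set \<Rightarrow> real^2 \<Rightarrow> (int \<Rightarrow> real^2) \<Rightarrow> int \<Rightarrow> int \<Rightarrow> real^2 \<Rightarrow> bool" where
  "labelling_run S B0 c p a b p01 \<longleftrightarrow>
     a \<ge> 1 \<and> b \<ge> 1 \<and>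
     closest_unlabelled S {} c (p 0) \<and>
     closest_unlabelled S {p 0} (p 0) (p 1) \<and>
     (\<forall>n\<in>{2..a}. closest_unlabelled S (p ` {0..n-1}) (p (n-1) + (p (n-1) - p (n-2))) (p n)
        \<and> p n \<in> B0) \<and>
     (\<exists>q. closest_unlabelled S (p ` {0..a}) (p a + (p a - p (a-1))) q \<and> q \<notin> B0) \<and>
     closest_unlabelled S (p ` {0..a}) (2 *\<^sub>R p 0 - p 1) (p (-1)) \<and>
     (\<forall>n\<in>{-b..-2}. closest_unlabelled S (p ` {n+1..a}) (p (n+1) + (p (n+1) - p (n+2))) (p n)
        \<and> p n \<in> B0) \<and>
     (\<exists>q. closest_unlabelled S (p ` {-b..a}) (p (-b) + (p (-b) - p (-b+1))) q \<and> q \<notin> B0) \<and>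
     closest_unlabelled S (p ` {-b..a}) (p 0) p01"

definition labelling_output ::
  "(real^2) set \<Rightarrow> (real^2) set \<Rightarrow> real^2 \<Rightarrow> real^2 \<Rightarrow> real^2 \<Rightarrow> real^2 \<Rightarrow> bool" where
  "labelling_output S B0 c p00 p10 p01 \<longleftrightarrow>
     (\<exists>p a b. labelling_run S B0 c p a b p01 \<and> p00 = p 0 \<and> p10 = p 1)"


section \<open>Bases of the integer lattice\<close>

global_interpretation int_vec: module "(*s) :: int \<Rightarrow> int^'n \<Rightarrow> int^'n"
  by standard (simp_all add: vec_eq_iff algebra_simps)

definition int_basis_pair :: "int^2 \<Rightarrow> int^2 \<Rightarrow> bool" where
  "int_basis_pair z1 z2 \<longleftrightarrow>
     z1 \<noteq> z2 \<and> int_vec.independent {z1, z2} \<and> int_vec.span {z1, z2} = UNIV"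

end

theory Submission
  imports Defs
begin

text \<open>Near a point \<open>q\<close>, the point set \<open>L h\<close> looks at scale \<open>h\<close> like the image of the integer lattice under the
  linear map \<open>h D\<^sub>q\<close>, where \<open>D\<^sub>q\<close> is the derivative of the leading term \<open>g\<^sub>0\<close> of the chart at
  \<open>g\<^sub>0\<^sup>-\<^sup>1(q)\<close>: differences of lattice points are \<open>h D\<^sub>q\<close> applied to the difference of their labels, up to an
  error \<open>\<epsilon> h\<close>, uniformly for \<open>q\<close> in a compact subset of \<open>B\<close> (\<open>eventually_locally_affine\<close>). An error \<open>o(h)\<close>
  already suffices for everything below, because nearby lattice points are at distance at least a
  constant times \<open>h\<close>; so only \<open>G\<^sub>h = g\<^sub>0 + h g\<^sub>1 + O(h\<^sup>2)\<close> in the supremum norm is needed, together with the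
  uniform differentiability of \<open>g\<^sub>0\<close> on compact sets.

  Let \<open>M = D\<^sub>c\<close>, and measure an integer vector \<open>w\<close> by \<open>|M w|\<close>. Below a given bound these lengths take only
  finitely many values, so there is a positive gap between two different ones. Once the error is below
  that gap, comparing distances in \<open>L h\<close> near \<open>c\<close> is the same as comparing lengths
  (\<open>closest_label_shortest\<close>). Hence the first step of the algorithm selects a shortest nonzero vector
  \<open>z\<^sub>1\<close>.

  The point labelled \<open>(0, 1)\<close> is a closest point that is not yet labelled, so one must know which points
  the chain in the first direction has used. Along the chain the extrapolated point
  \<open>\<lambda>\<^sub>n\<^sub>-\<^sub>1 + (\<lambda>\<^sub>n\<^sub>-\<^sub>1 - \<lambda>\<^sub>n\<^sub>-\<^sub>2)\<close> is within \<open>2 \<epsilon> h\<close> of the lattice point with the next label in direction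
  \<open>z\<^sub>1\<close>, and all other lattice points are farther away (\<open>locally_affine_extrapolation\<close>). So the chain
  carries the labels \<open>k\<^sub>0 + n z\<^sub>1\<close> however far it runs in \<open>B0\<close>, and it never leaves that line. On the other hand it
  is stopped only by leaving \<open>B0\<close>, which contains a fixed ball around \<open>c\<close>; so it uses every label
  \<open>k\<^sub>0 + n z\<^sub>1\<close> with \<open>|M (n z\<^sub>1)|\<close> bounded. Therefore \<open>z\<^sub>2\<close> is a shortest vector among those that are not multiples
  of \<open>z\<^sub>1\<close> (\<open>labelling_run_gives_basis\<close>), and a pair of successive minima is a basis of the plane
  lattice (\<open>reduced_pair_is_basis\<close>).\<close>

section \<open>Integer vectors and reduced bases\<close>

definition int_point :: "int^'n \<Rightarrow> real^'n" where
  "int_point w = (\<chi> i. real_of_int (w $ i))"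

lemma int_point_nth [simp]: "int_point w $ i = real_of_int (w $ i)"
  by (simp add: int_point_def)

lemma int_point_add: "int_point (v + w) = int_point v + int_point w"
  and int_point_diff: "int_point (v - w) = int_point v - int_point w"
  and int_point_minus: "int_point (- w) = - int_point w"
  and int_point_scale: "int_point (n *s w) = real_of_int n *\<^sub>R int_point w"
  and int_point_0 [simp]: "int_point 0 = 0"
  by (simp_all add: vec_eq_iff)

lemma int_point_eq_iff: "int_point v = int_point w \<longleftrightarrow> v = w"
  by (simp add: vec_eq_iff)

lemma scaled_int_point: "scaled h w = h *\<^sub>R int_point w"
  by (simp add: scaled_def vec_eq_iff)

lemma norm_int_point_ge_1:
  assumes "w \<noteq> 0" shows "1 \<le> norm (int_point w)"
proof -
  obtain i where "w $ i \<noteq> 0" using assms by (auto simp: vec_eq_iff)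
  then have "1 \<le> \<bar>int_point w $ i\<bar>" by simp
  then show ?thesis using component_le_norm_cart[of "int_point w" i] by linarith
qed

lemma finite_int_points_bounded: "finite {w :: int^'n. norm (int_point w) \<le> r}"
proof -
  have "vec_nth ` {w :: int^'n. norm (int_point w) \<le> r} \<subseteq> (UNIV \<rightarrow>\<^sub>E {-\<lceil>r\<rceil>..\<lceil>r\<rceil>})"
  proof (safe intro!: PiE_I)
    fix w :: "int^'n" and i assume "norm (int_point w) \<le> r"
    then have "\<bar>real_of_int (w $ i)\<bar> \<le> r"
      using component_le_norm_cart[of "int_point w" i] by simp
    then show "w $ i \<in> {-\<lceil>r\<rceil>..\<lceil>r\<rceil>}" by (simp; linarith)
  qed auto
  then have "finite (vec_nth ` {w :: int^'n. norm (int_point w) \<le> r})"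
    by (rule finite_subset) (simp add: finite_PiE)
  then show ?thesis by (rule finite_imageD) (simp add: inj_on_def vec_nth_inject)
qed

lemma exists_int_point_near:
  fixes x :: "real^2" assumes "h > 0"
  obtains w where "norm (scaled h w - x) \<le> h"
proof -
  define w :: "int^2" where "w = (\<chi> i. round (x $ i / h))"
  have "\<bar>(scaled h w - x) $ i\<bar> \<le> h / 2" for i
  proof -
    have "\<bar>real_of_int (round (x $ i / h)) - x $ i / h\<bar> \<le> 1/2"
      by (rule of_int_round_abs_le)
    then have "h * \<bar>real_of_int (round (x $ i / h)) - x $ i / h\<bar> \<le> h * (1/2)"
      using assms by (intro mult_left_mono) auto
    also have "h * \<bar>real_of_int (round (x $ i / h)) - x $ i / h\<bar>
        = \<bar>h * (real_of_int (round (x $ i / h)) - x $ i / h)\<bar>"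
      using assms by (simp add: abs_mult)
    also have "h * (real_of_int (round (x $ i / h)) - x $ i / h) = (scaled h w - x) $ i"
      using assms by (simp add: scaled_def w_def field_simps)
    finally show ?thesis by simp
  qed
  then have "norm (scaled h w - x) \<le> (\<Sum>i\<in>(UNIV::2 set). h / 2)"
    by (intro order_trans[OF norm_le_l1_cart] sum_mono)
  then show ?thesis using that by simp
qed

text \<open>Reduction theory in dimension two. Reducing the two real coordinates of an integer vector to
  absolute value at most \<open>1/2\<close> leaves a remainder \<open>w'\<close>. Since \<open>z2 \<plusminus> z1\<close> is not shorter than \<open>z2\<close>, the
  inner product of the images \<open>a\<close>, \<open>b\<close> satisfies \<open>2 |a \<bullet> b| \<le> |a|\<^sup>2\<close>, and this makes the remainder
  strictly shorter than \<open>z2\<close>: its squared length is at most \<open>(|a|\<^sup>2 + |b|\<^sup>2 + |a|\<^sup>2) / 4 \<le> 3/4 |b|\<^sup>2\<close>. By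
  minimality it is then a multiple of \<open>z1\<close>.\<close>

lemma reduced_pair_is_basis:
  fixes M :: "real^2 \<Rightarrow> real^2" and z1 z2 :: "int^2"
  assumes M: "linear M" "\<And>v. v \<noteq> 0 \<Longrightarrow> M v \<noteq> 0"
    and z1: "z1 \<noteq> 0" "\<And>w. w \<noteq> 0 \<Longrightarrow> norm (M (int_point z1)) \<le> norm (M (int_point w))"
    and z2: "z2 \<notin> range (\<lambda>n. n *s z1)"
      "\<And>w. w \<notin> range (\<lambda>n. n *s z1) \<Longrightarrow> norm (M (int_point z2)) \<le> norm (M (int_point w))"
  shows "int_basis_pair z1 z2"
proof -
  define a where "a = M (int_point z1)"
  define b where "b = M (int_point z2)"
  define d where "d = z1$1 * z2$2 - z1$2 * z2$1"
  note lin = linear_add[OF M(1)] linear_diff[OF M(1)] linear_scale[OF M(1)] linear_0[OF M(1)]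
  have "z2 \<noteq> 0" using z2(1) by (metis rangeI vector_smult_lzero)
  have a0: "a \<noteq> 0" using M(2) z1(1) int_point_eq_iff[of z1 0] unfolding a_def by auto
  have ab: "norm a \<le> norm b" using z1(2)[OF \<open>z2 \<noteq> 0\<close>] by (simp add: a_def b_def)
  \<comment> \<open>If the determinant vanished, \<open>z2\<close> would be a real multiple \<open>t z1\<close>, and
    \<open>z2 - round t z1\<close> would be shorter than \<open>z1\<close>.\<close>
  have d0: "d \<noteq> 0"
  proof
    assume d: "d = 0"
    obtain i where i: "z1 $ i \<noteq> 0" using z1(1) by (auto simp: vec_eq_iff)
    define t where "t = real_of_int (z2 $ i) / real_of_int (z1 $ i)"
    have "z1 $ i * z2 $ j = z2 $ i * z1 $ j" for j
      using exhaust_2[of i] exhaust_2[of j] d by (auto simp: d_def algebra_simps)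
    then have "real_of_int (z1 $ i) * real_of_int (z2 $ j) = real_of_int (z2 $ i) * real_of_int (z1 $ j)" for j
      by (metis of_int_mult)
    then have t: "int_point z2 = t *\<^sub>R int_point z1"
      using i by (simp add: vec_eq_iff t_def field_simps)
    define w where "w = z2 - round t *s z1"
    have "int_point w = (t - real_of_int (round t)) *\<^sub>R int_point z1"
      by (simp add: w_def int_point_diff int_point_scale t algebra_simps)
    then have "norm (M (int_point w)) = \<bar>t - real_of_int (round t)\<bar> * norm a"
      by (simp add: lin a_def)
    also have "\<dots> \<le> 1/2 * norm a"
      using of_int_round_abs_le[of t] by (intro mult_right_mono) (auto simp: abs_minus_commute)
    also have "\<dots> < norm a" using a0 by simp
    finally have "w = 0" using z1(2)[of w] unfolding a_def by fastforce
    then have "z2 = round t *s z1" by (simp add: w_def)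
    then show False using z2(1) by blast
  qed
  have not_mult: "z2 + n *s z1 \<notin> range (\<lambda>n. n *s z1)" for n
  proof
    assume "z2 + n *s z1 \<in> range (\<lambda>n. n *s z1)"
    then obtain m where "z2 + n *s z1 = m *s z1" by blast
    then have "z2 = (m - n) *s z1" by (metis add_diff_cancel_right' vector_sub_rdistrib)
    then show False using z2(1) by blast
  qed
  have inner: "2 * \<bar>a \<bullet> b\<bar> \<le> (norm a)\<^sup>2"
  proof -
    have "(norm b)\<^sup>2 \<le> (norm (b + real_of_int n *\<^sub>R a))\<^sup>2" for n
      using z2(2)[OF not_mult[of n]]
      by (intro power_mono) (simp_all add: lin int_point_add int_point_scale a_def b_def)
    from this[of 1] this[of "-1"] show ?thesis
      by (auto simp: power2_norm_eq_inner inner_simps inner_commute abs_if)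
  qed
  have span: "w \<in> int_vec.span {z1, z2}" for w
  proof -
    \<comment> \<open>Cramer's rule: \<open>s\<close>, \<open>t\<close> are the real coordinates of \<open>w\<close>.\<close>
    define s where "s = real_of_int (w$1 * z2$2 - w$2 * z2$1) / real_of_int d"
    define t where "t = real_of_int (z1$1 * w$2 - z1$2 * w$1) / real_of_int d"
    define s' where "s' = s - real_of_int (round s)"
    define t' where "t' = t - real_of_int (round t)"
    have "real_of_int d * real_of_int (w $ i) = real_of_int (w$1 * z2$2 - w$2 * z2$1) * real_of_int (z1 $ i)
        + real_of_int (z1$1 * w$2 - z1$2 * w$1) * real_of_int (z2 $ i)" for i
      unfolding of_int_mult[symmetric] of_int_add[symmetric] of_int_eq_iff
      using exhaust_2[of i] by (auto simp: d_def algebra_simps)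
    then have w: "real_of_int (w $ i) = (real_of_int (w$1 * z2$2 - w$2 * z2$1) * real_of_int (z1 $ i)
        + real_of_int (z1$1 * w$2 - z1$2 * w$1) * real_of_int (z2 $ i)) / real_of_int d" for i
      using d0 by (metis nonzero_mult_div_cancel_left of_int_eq_0_iff)
    have "int_point w = s *\<^sub>R int_point z1 + t *\<^sub>R int_point z2"
      unfolding vec_eq_iff int_point_nth vector_add_component vector_scaleR_component s_def t_def
      by (subst w) (simp add: add_divide_distrib)
    moreover define w' where "w' = w - round s *s z1 - round t *s z2"
    ultimately have "int_point w' = s' *\<^sub>R int_point z1 + t' *\<^sub>R int_point z2"
      unfolding w'_def int_point_diff int_point_scale s'_def t'_def by (simp add: algebra_simps)
    then have Mw': "M (int_point w') = s' *\<^sub>R a + t' *\<^sub>R b"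
      by (simp add: lin a_def b_def)
    have s': "\<bar>s'\<bar> \<le> 1/2" and t': "\<bar>t'\<bar> \<le> 1/2"
      using of_int_round_abs_le[of s] of_int_round_abs_le[of t]
      by (auto simp: s'_def t'_def abs_minus_commute)
    have "s'\<^sup>2 \<le> (1/2)\<^sup>2" "t'\<^sup>2 \<le> (1/2)\<^sup>2" and st: "\<bar>s' * t'\<bar> \<le> 1/2 * (1/2)"
      using s' t' by (simp_all only: abs_le_square_iff[symmetric] abs_mult mult_mono abs_ge_zero)
    moreover have "(norm (M (int_point w')))\<^sup>2 = s'\<^sup>2 * (norm a)\<^sup>2 + t'\<^sup>2 * (norm b)\<^sup>2 + 2 * (s' * t') * (a \<bullet> b)"
      unfolding Mw' power2_norm_eq_inner by (simp add: inner_simps inner_commute power2_eq_square algebra_simps)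
    moreover have "2 * (s' * t') * (a \<bullet> b) \<le> \<bar>s' * t'\<bar> * (2 * \<bar>a \<bullet> b\<bar>)"
      using abs_ge_self[of "s' * t' * (2 * (a \<bullet> b))"] by (simp add: abs_mult algebra_simps)
    moreover have "s'\<^sup>2 * (norm a)\<^sup>2 \<le> (1/2)\<^sup>2 * (norm a)\<^sup>2" "t'\<^sup>2 * (norm b)\<^sup>2 \<le> (1/2)\<^sup>2 * (norm b)\<^sup>2"
      using calculation by (auto intro!: mult_right_mono)
    moreover have "\<bar>s' * t'\<bar> * (2 * \<bar>a \<bullet> b\<bar>) \<le> 1/2*(1/2) * (norm a)\<^sup>2"
      by (rule mult_mono[OF st inner]) auto
    moreover have "(norm a)\<^sup>2 \<le> (norm b)\<^sup>2" "0 < (norm a)\<^sup>2" using ab a0 by (auto intro: power_mono)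
    ultimately have "(norm (M (int_point w')))\<^sup>2 < (norm b)\<^sup>2" by (simp add: power2_eq_square)
    then have "norm (M (int_point w')) < norm b" by (rule power2_less_imp_less) simp
    then obtain n where n: "w' = n *s z1" using z2(2)[of w'] unfolding b_def by fastforce
    have "w = n *s z1 + round s *s z1 + round t *s z2"
      using n unfolding w'_def by (simp add: algebra_simps)
    moreover have "\<dots> \<in> int_vec.span {z1, z2}"
      by (intro int_vec.span_add int_vec.span_scale int_vec.span_base) auto
    ultimately show ?thesis by simp
  qed
  have "z1 \<noteq> z2" using z2(1) by (metis rangeI vector_smult_lid)
  moreover have "\<not> int_vec.dependent {z1, z2}"
  proof
    assume "int_vec.dependent {z1, z2}"
    then obtain u where u: "u z1 \<noteq> 0 \<or> u z2 \<noteq> 0" "u z1 *s z1 + u z2 *s z2 = 0"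
      using \<open>z1 \<noteq> z2\<close> by (auto simp: int_vec.dependent_finite)
    then have *: "u z1 * z1 $ i + u z2 * z2 $ i = 0" for i by (auto simp: vec_eq_iff)
    have "u z1 * d = z2$2 * (u z1 * z1$1 + u z2 * z2$1) - z2$1 * (u z1 * z1$2 + u z2 * z2$2)"
      "u z2 * d = z1$1 * (u z1 * z1$2 + u z2 * z2$2) - z1$2 * (u z1 * z1$1 + u z2 * z2$1)"
      by (auto simp: d_def algebra_simps)
    then show False using u(1) d0 * by auto
  qed
  ultimately show ?thesis unfolding int_basis_pair_def using span by blast
qed

section \<open>Uniform linearization of smooth maps\<close>

lemma compact_thickening:
  fixes K U :: "'a::euclidean_space set"
  assumes "compact K" "open U" "K \<subseteq> U"
  obtains r where "r > 0" "compact (\<Union>x\<in>K. cball x r)" "(\<Union>x\<in>K. cball x r) \<subseteq> U"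
proof -
  obtain r where r: "r > 0" "(\<Union>x\<in>K. cball x r) \<subseteq> U"
    using compact_subset_open_imp_cball_epsilon_subset[OF assms] .
  have "(\<Union>x\<in>K. cball x r) = {x + y | x y. x \<in> K \<and> y \<in> cball 0 r}"
    by (force simp: dist_norm norm_minus_commute intro: exI[of _ "_ - _"])
  then have "compact (\<Union>x\<in>K. cball x r)"
    using compact_sums[OF assms(1) compact_cball[of 0 r]] by simp
  with r that show thesis by blast
qed

lemma smooth_on_has_derivative:
  assumes "smooth_on U f" "x \<in> U"
  shows "(f has_derivative frechet_derivative f (at x)) (at x)"
  using assms frechet_derivative_works[of f "at x"] unfolding smooth_on_def
  by (metis partials.simps(1))

lemma frechet_derivative_eq_sum_partials:
  assumes "smooth_on U f" "x \<in> U"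
  shows "frechet_derivative f (at x) v = (\<Sum>i\<in>UNIV. v $ i *\<^sub>R partials [i] f x)"
proof -
  interpret linear "frechet_derivative f (at x)"
    using smooth_on_has_derivative[OF assms] by (rule has_derivative_linear)
  have "frechet_derivative f (at x) v = frechet_derivative f (at x) (\<Sum>i\<in>UNIV. v $ i *\<^sub>R axis i 1)"
    using basis_expansion[of v] by (simp add: scalar_mult_eq_scaleR)
  then show ?thesis by (simp add: sum scale)
qed

lemma continuous_on_partials:
  assumes "smooth_on U f" shows "continuous_on U (partials is f)"
  using assms unfolding smooth_on_def
  by (metis continuous_at_imp_continuous_on differentiable_imp_continuous_within)

lemma derivative_bounded_on_compact:
  assumes "smooth_on U f" "compact K" "K \<subseteq> U"
  obtains C where "C > 0" "\<And>x v. x \<in> K \<Longrightarrow> norm (frechet_derivative f (at x) v) \<le> C * norm v"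
proof -
  have "\<exists>c. \<forall>x\<in>K. norm (partials [i] f x) \<le> c" for i
    using compact_imp_bounded[OF compact_continuous_image[OF
        continuous_on_subset[OF continuous_on_partials[OF assms(1), of "[i]"] assms(3)] assms(2)]]
    by (auto simp: bounded_iff)
  then obtain c where c: "\<And>i x. x \<in> K \<Longrightarrow> norm (partials [i] f x) \<le> c i" by metis
  have "norm (frechet_derivative f (at x) v) \<le> ((\<Sum>i\<in>UNIV. \<bar>c i\<bar>) + 1) * norm v" if "x \<in> K" for x v
  proof -
    have "norm (frechet_derivative f (at x) v) \<le> (\<Sum>i\<in>UNIV. norm (v $ i *\<^sub>R partials [i] f x))"
      unfolding frechet_derivative_eq_sum_partials[OF assms(1) subsetD[OF assms(3) that]]
      by (rule norm_sum)
    also have "\<dots> \<le> (\<Sum>i\<in>UNIV. \<bar>c i\<bar> * norm v)"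
    proof (rule sum_mono)
      fix i show "norm (v $ i *\<^sub>R partials [i] f x) \<le> \<bar>c i\<bar> * norm v"
        using c[OF that, of i] component_le_norm_cart[of v i]
        by (simp add: mult.commute[of "\<bar>c i\<bar>"] mult_mono)
    qed
    finally show ?thesis by (simp add: sum_distrib_right distrib_right add_increasing2)
  qed
  moreover have "(\<Sum>i\<in>UNIV. \<bar>c i\<bar>) + 1 > 0" by (simp add: sum_nonneg add_nonneg_pos)
  ultimately show thesis using that by blast
qed

text \<open>The partial derivatives are uniformly continuous on a compact neighbourhood of \<open>K\<close>; the mean value
  inequality turns this into a first-order expansion that is uniform over the base points in \<open>K\<close>.\<close>

lemma smooth_on_uniformly_differentiable:
  fixes f :: "real^'n \<Rightarrow> 'b::real_normed_vector"
  assumes f: "smooth_on U f" and U: "open U" and K: "compact K" "K \<subseteq> U" and "e > 0"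
  obtains d where "d > 0" "\<And>x v. x \<in> K \<Longrightarrow> norm v \<le> d \<Longrightarrow> x + v \<in> U"
    "\<And>x v. x \<in> K \<Longrightarrow> norm v \<le> d \<Longrightarrow>
      norm (f (x + v) - f x - frechet_derivative f (at x) v) \<le> e * norm v"
proof -
  obtain r where r: "r > 0" "compact (\<Union>x\<in>K. cball x r)" "(\<Union>x\<in>K. cball x r) \<subseteq> U"
    using compact_thickening[OF K(1) U K(2)] .
  define K' where "K' = (\<Union>x\<in>K. cball x r)"
  define e' where "e' = e / CARD('n)"
  have e': "e' > 0" using \<open>e > 0\<close> by (simp add: e'_def)
  have "\<exists>d>0. \<forall>x\<in>K'. \<forall>y\<in>K'. dist y x < d \<longrightarrow> dist (partials [i] f y) (partials [i] f x) < e'" for i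
    using compact_uniformly_continuous[OF continuous_on_subset[OF continuous_on_partials[OF f, of "[i]"]]] r e'
    unfolding uniformly_continuous_on_def K'_def by blast
  then obtain d where d: "\<And>i. d i > 0"
    "\<And>i x y. x \<in> K' \<Longrightarrow> y \<in> K' \<Longrightarrow> dist y x < d i \<Longrightarrow> dist (partials [i] f y) (partials [i] f x) < e'"
    by metis
  \<comment> \<open>Half the minimum, so that distances up to \<open>m\<close> lie strictly below every \<open>d i\<close>.\<close>
  define m where "m = Min (insert r (d ` UNIV)) / 2"
  have m: "m > 0" "m \<le> r" "m < d i" for i
  proof -
    have "Min (insert r (d ` UNIV)) > 0" using r d by simp
    moreover have "Min (insert r (d ` UNIV)) \<le> r" "Min (insert r (d ` UNIV)) \<le> d i"
      by (rule Min_le; simp)+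
    ultimately show "m > 0" "m \<le> r" "m < d i" unfolding m_def by linarith+
  qed
  show thesis
  proof
    show "m > 0" by fact
    show "x + v \<in> U" if "x \<in> K" "norm v \<le> m" for x v
    proof -
      have "x + v \<in> cball x r" using that m by (simp add: dist_norm)
      then show ?thesis using that r(3) by blast
    qed
    show "norm (f (x + v) - f x - frechet_derivative f (at x) v) \<le> e * norm v"
      if x: "x \<in> K" and v: "norm v \<le> m" for x v
    proof -
      have sub: "cball x m \<subseteq> K'" using m x unfolding K'_def by fastforce
      have "norm (f (x + v) - f x - frechet_derivative f (at x) (x + v - x)) \<le> norm (x + v - x) * e"
      proof (rule differentiable_bound_linearization[where S = "cball x m"])
        show "x + t *\<^sub>R (x + v - x) \<in> cball x m" if "t \<in> {0..1}" for t
        proof -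
          have "\<bar>t\<bar> * norm v \<le> 1 * m" using that v by (intro mult_mono) auto
          then show ?thesis by (simp add: dist_norm)
        qed
        show "(f has_derivative frechet_derivative f (at y)) (at y within cball x m)" if "y \<in> cball x m" for y
          using smooth_on_has_derivative[OF f, of y] that sub r(3) K'_def has_derivative_at_withinI by blast
        show "x \<in> cball x m" using m by simp
        show "onorm (frechet_derivative f (at y) - frechet_derivative f (at x)) \<le> e" if y: "y \<in> cball x m" for y
        proof (rule onorm_le)
          fix w
          have xy: "x \<in> K'" "y \<in> K'" using y sub m(1) by auto
          then have xyU: "x \<in> U" "y \<in> U" using r(3) unfolding K'_def by blast+
          have "(frechet_derivative f (at y) - frechet_derivative f (at x)) w
              = (\<Sum>i\<in>UNIV. w $ i *\<^sub>R (partials [i] f y - partials [i] f x))"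
            unfolding fun_diff_def frechet_derivative_eq_sum_partials[OF f xyU(1)]
              frechet_derivative_eq_sum_partials[OF f xyU(2)]
            by (simp add: sum_subtractf[symmetric] scaleR_diff_right del: partials.simps)
          also have "norm \<dots> \<le> (\<Sum>i\<in>(UNIV::'n set). norm w * e')"
          proof (rule sum_norm_le)
            fix i :: 'n
            have "dist y x < d i" using y m(3)[of i] by (simp add: dist_commute)
            then have "norm (partials [i] f y - partials [i] f x) \<le> e'"
              using d(2)[OF xy, of i] by (simp add: dist_norm less_imp_le del: partials.simps)
            then show "norm (w $ i *\<^sub>R (partials [i] f y - partials [i] f x)) \<le> norm w * e'"
              unfolding norm_scaleR using component_le_norm_cart[of w i] by (intro mult_mono) auto
          qed
          also have "\<dots> = e * norm w" by (simp add: e'_def)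
          finally show "norm ((frechet_derivative f (at y) - frechet_derivative f (at x)) w) \<le> e * norm w" .
        qed
      qed
      then show ?thesis by (simp add: mult.commute)
    qed
  qed
qed

section \<open>Local affine structure of an asymptotic lattice\<close>

text \<open>At scale \<open>h\<close> around \<open>q\<close>, the labelled point set \<open>S\<close> is an affine image of the integer lattice under \<open>h D\<close>, up
  to \<open>\<epsilon> h\<close>: label differences predict differences of points, and every label reached by a bounded step is
  taken. Only differences occur, because the offset of the lattice relative to \<open>q\<close> varies with \<open>h\<close>.\<close>

definition locally_affine ::
  "(real^2) set \<Rightarrow> (real^2 \<Rightarrow> int^2) \<Rightarrow> (real^2 \<Rightarrow> real^2) \<Rightarrow> real \<Rightarrow> real \<Rightarrow> real \<Rightarrow> real^2 \<Rightarrow> bool" where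
  "locally_affine S \<kappa> D h \<rho> \<epsilon> q \<longleftrightarrow>
     (\<forall>l\<in>S. \<forall>l'\<in>S. dist l q \<le> \<rho> * h \<longrightarrow> dist l' q \<le> \<rho> * h \<longrightarrow>
        norm (l' - l - h *\<^sub>R D (int_point (\<kappa> l' - \<kappa> l))) \<le> \<epsilon> * h) \<and>
     (\<forall>l\<in>S. \<forall>z. dist l q \<le> \<rho> * h \<longrightarrow> norm (int_point z) \<le> \<rho> \<longrightarrow>
        (\<exists>l'\<in>S. \<kappa> l' = \<kappa> l + z \<and> norm (l' - l - h *\<^sub>R D (int_point z)) \<le> \<epsilon> * h))"

lemma norm_diff_mono: "norm a \<le> r \<Longrightarrow> norm b \<le> s \<Longrightarrow> norm (a - b) \<le> r + s"
  by (rule norm_triangle_le_diff) (rule add_mono)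

text \<open>A labelled asymptotic lattice together with its chart and a compact set \<open>Q\<close> over which the estimates
  are uniform. Statements about small \<open>h\<close> are phrased with the filter \<open>at 0 within I\<close>.\<close>

locale charted_lattice =
  fixes L :: "real \<Rightarrow> (real^2) set" and I :: "real set" and B Q U V :: "(real^2) set"
    and \<kappa> :: "real \<Rightarrow> real^2 \<Rightarrow> int^2" and G :: "real \<Rightarrow> real^2 \<Rightarrow> real^2"
    and g :: "nat \<Rightarrow> real^2 \<Rightarrow> real^2" and C :: "nat \<Rightarrow> real"
  assumes I_pos: "I \<subseteq> {0<..}"
    and B: "open B" "closure B \<subseteq> V"
    and Q: "compact Q" "Q \<subseteq> B"
    and expansion: "smooth_expansion I U G g"
    and diffeo: "oriented_diffeomorphism U V (g 0)"
    and label_exists: "open U0 \<Longrightarrow> compactly_contained U0 {x\<in>U. g 0 x \<in> B} \<Longrightarrow>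
      \<exists>h0>0. \<forall>h\<in>I. h \<le> h0 \<longrightarrow> (\<forall>k. scaled h k \<in> U0 \<longrightarrow> (\<exists>l\<in>L h. label_estimate G C h l k))"
    and labelling: "\<exists>h0>0. \<forall>h\<in>I. h \<le> h0 \<longrightarrow> inj_on (\<kappa> h) (L h) \<and>
      (\<forall>l\<in>L h. scaled h (\<kappa> h l) \<in> U \<and> label_estimate G C h l (\<kappa> h l))"
begin

abbreviation "small \<equiv> at 0 within I"

definition \<phi> :: "real^2 \<Rightarrow> real^2" where "\<phi> = inv_into U (g 0)"

definition D :: "real^2 \<Rightarrow> real^2 \<Rightarrow> real^2" where "D q = frechet_derivative (g 0) (at (\<phi> q))"

lemma eventually_smallI:
  assumes "h0 > 0" "\<And>h. h \<in> I \<Longrightarrow> h > 0 \<Longrightarrow> h \<le> h0 \<Longrightarrow> P h"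
  shows "eventually P small"
  unfolding eventually_at using assms I_pos
  by (intro exI[of _ h0]) (auto simp: dist_real_def subset_iff)

lemma eventually_small_mult_le:
  assumes "e > 0" shows "\<forall>\<^sub>F h in small. h \<in> I \<and> h > 0 \<and> c * h \<le> e"
proof (rule eventually_smallI[of "e / (\<bar>c\<bar> + 1)"])
  fix h assume h: "h \<in> I" "h > 0" "h \<le> e / (\<bar>c\<bar> + 1)"
  have "c * h \<le> (\<bar>c\<bar> + 1) * h" using h by (intro mult_right_mono) auto
  also have "\<dots> \<le> e" using h(3) by (simp add: field_simps)
  finally show "h \<in> I \<and> h > 0 \<and> c * h \<le> e" using h by simp
qed (use assms in auto)

lemma open_U: "open U" and open_V: "open V" and bij: "bij_betw (g 0) U V"
  and smooth_\<phi>: "smooth_on V \<phi>" and smooth_g: "smooth_on U (g j)"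
  using diffeo expansion by (auto simp: oriented_diffeomorphism_def smooth_expansion_def \<phi>_def)

lemma \<phi>_g [simp]: "x \<in> U \<Longrightarrow> \<phi> (g 0 x) = x"
  using bij by (simp add: \<phi>_def bij_betw_inv_into_left)

lemma g_\<phi> [simp]: "q \<in> V \<Longrightarrow> g 0 (\<phi> q) = q"
  using bij by (simp add: \<phi>_def bij_betw_inv_into_right)

lemma \<phi>_mem: "q \<in> V \<Longrightarrow> \<phi> q \<in> U"
  using bij by (metis \<phi>_def bij_betw_imp_surj_on inv_into_into)

lemma Q_V: "Q \<subseteq> V" using Q B closure_subset by blast

lemma compact_\<phi>Q: "compact (\<phi> ` Q)"
  using compact_continuous_image[OF continuous_on_subset[OF continuous_on_partials[OF smooth_\<phi>, of "[]"] Q_V]] Q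
  by simp

lemma \<phi>Q_subset: "\<phi> ` Q \<subseteq> {x\<in>U. g 0 x \<in> B}"
  using Q Q_V \<phi>_mem by (auto simp: subset_iff)

lemma linear_D: assumes "q \<in> Q" shows "linear (D q)"
  unfolding D_def using smooth_on_has_derivative[OF smooth_g, of "\<phi> q" 0] \<phi>_mem assms Q_V
  by (meson has_derivative_linear subsetD)

text \<open>The upper bound is compactness; the lower bound holds because the derivative of \<open>\<phi>\<close> inverts \<open>D q\<close> and is
  itself bounded on \<open>Q\<close>.\<close>

lemma D_bounds:
  obtains m m' where "m > 0" "m' > 0" "\<And>q v. q \<in> Q \<Longrightarrow> m * norm v \<le> norm (D q v)"
    "\<And>q v. q \<in> Q \<Longrightarrow> norm (D q v) \<le> m' * norm v"
proof -
  have "\<phi> ` Q \<subseteq> U" using \<phi>Q_subset by auto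
  from derivative_bounded_on_compact[OF smooth_g[of 0] compact_\<phi>Q this]
  obtain m' where m': "m' > 0" "\<And>q v. q \<in> Q \<Longrightarrow> norm (D q v) \<le> m' * norm v"
    unfolding D_def by (metis imageI)
  obtain c where c: "c > 0" "\<And>q v. q \<in> Q \<Longrightarrow> norm (frechet_derivative \<phi> (at q) v) \<le> c * norm v"
    using derivative_bounded_on_compact[OF smooth_\<phi> Q(1) Q_V] by metis
  have "1 / c * norm v \<le> norm (D q v)" if q: "q \<in> Q" for q v
  proof -
    have qV: "q \<in> V" "\<phi> q \<in> U" using q Q_V \<phi>_mem by auto
    have "(g 0 has_derivative D q) (at (\<phi> q))"
      unfolding D_def by (rule smooth_on_has_derivative[OF smooth_g qV(2)])
    moreover have "(\<phi> has_derivative frechet_derivative \<phi> (at q)) (at (g 0 (\<phi> q)))"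
      using smooth_on_has_derivative[OF smooth_\<phi> qV(1)] qV by simp
    ultimately have "(\<phi> \<circ> g 0 has_derivative frechet_derivative \<phi> (at q) \<circ> D q) (at (\<phi> q))"
      by (rule diff_chain_at)
    moreover have "(\<phi> \<circ> g 0 has_derivative id) (at (\<phi> q))"
      by (rule has_derivative_transform_within_open[OF has_derivative_id open_U qV(2)]) simp
    ultimately have "frechet_derivative \<phi> (at q) \<circ> D q = id" by (rule has_derivative_unique)
    then have "frechet_derivative \<phi> (at q) (D q v) = v" by (metis comp_apply id_apply)
    then show ?thesis using c(2)[OF q, of "D q v"] c(1) by (simp add: field_simps)
  qed
  with m' c(1) show thesis using that[of "1 / c" m'] by simp
qed

lemma G_approximation:
  obtains K where "K > 0" "\<forall>\<^sub>F h in small. \<forall>x\<in>U. norm (G h x - g 0 x) \<le> K * h"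
    "\<forall>\<^sub>F h in small. \<forall>x\<in>U. norm (G h x - g 0 x - h *\<^sub>R g 1 x) \<le> K * h^2"
proof -
  have *: "\<exists>K. \<forall>\<^sub>F h in small. \<forall>x\<in>U. norm (partials [] (\<lambda>y. G h y - (\<Sum>j<N. h ^ j *\<^sub>R g j y)) x) \<le> K * h ^ N" for N
    using expansion unfolding smooth_expansion_def by blast
  obtain K1 where K1: "\<forall>\<^sub>F h in small. \<forall>x\<in>U. norm (G h x - g 0 x) \<le> K1 * h"
    using *[of 1] by auto
  obtain K2 where K2: "\<forall>\<^sub>F h in small. \<forall>x\<in>U. norm (G h x - g 0 x - h *\<^sub>R g 1 x) \<le> K2 * h^2"
    using *[of 2] by (auto simp: numeral_2_eq_2 diff_diff_eq)
  define K where "K = \<bar>K1\<bar> + \<bar>K2\<bar> + 1"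
  have pos: "\<forall>\<^sub>F h in small. h > 0" using eventually_small_mult_le[of 1 0] by (auto elim: eventually_mono)
  show thesis
  proof
    show "K > 0" by (simp add: K_def add_nonneg_pos)
    show "\<forall>\<^sub>F h in small. \<forall>x\<in>U. norm (G h x - g 0 x) \<le> K * h"
      using K1 pos
    proof eventually_elim
      case (elim h)
      then have "K1 * h \<le> K * h" by (intro mult_right_mono) (auto simp: K_def)
      then show ?case using elim by (meson order_trans)
    qed
    show "\<forall>\<^sub>F h in small. \<forall>x\<in>U. norm (G h x - g 0 x - h *\<^sub>R g 1 x) \<le> K * h^2"
      using K2 pos
    proof eventually_elim
      case (elim h)
      then have "K2 * h^2 \<le> K * h^2" by (intro mult_right_mono) (auto simp: K_def)
      then show ?case using elim by (meson order_trans)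
    qed
  qed
qed

text \<open>A bounded multiple of \<open>h\<close> away from \<open>\<phi> ` Q\<close> one is still inside a fixed open set compactly contained in
  the preimage of \<open>B\<close>, where the definition of a chart guarantees that integer vectors are labels.\<close>

lemma label_existence_near_Q:
  "\<forall>\<^sub>F h in small. \<forall>q\<in>Q. \<forall>u k. norm u \<le> R \<longrightarrow> scaled h k = \<phi> q + h *\<^sub>R u \<longrightarrow>
     (\<exists>l\<in>L h. label_estimate G C h l k)"
proof -
  have op: "open {x\<in>U. g 0 x \<in> B}"
    using continuous_open_preimage[OF continuous_on_partials[OF smooth_g[of 0], of "[]"] open_U B(1)]
    by (simp add: vimage_def Int_def)
  obtain r where r: "r > 0" "compact (\<Union>x\<in>\<phi> ` Q. cball x r)"
    "(\<Union>x\<in>\<phi> ` Q. cball x r) \<subseteq> {x\<in>U. g 0 x \<in> B}"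
    using compact_thickening[OF compact_\<phi>Q op \<phi>Q_subset] .
  define U0 where "U0 = (\<Union>x\<in>\<phi> ` Q. ball x r)"
  have "U0 \<subseteq> (\<Union>x\<in>\<phi> ` Q. cball x r)" unfolding U0_def by (intro UN_mono) auto
  then have sub: "closure U0 \<subseteq> (\<Union>x\<in>\<phi> ` Q. cball x r)"
    by (rule closure_minimal) (rule compact_imp_closed[OF r(2)])
  then have "compact (closure U0)"
    using compact_Int_closed[OF r(2) closed_closure[of U0]] by (simp add: Int_absorb1)
  then have contained: "compactly_contained U0 {x\<in>U. g 0 x \<in> B}"
    using order_trans[OF sub r(3)] unfolding compactly_contained_def by simp
  have "open U0" unfolding U0_def by (intro open_UN ballI open_ball)
  then obtain h0 where h0: "h0 > 0"
    "\<And>h k. h \<in> I \<Longrightarrow> h \<le> h0 \<Longrightarrow> scaled h k \<in> U0 \<Longrightarrow> \<exists>l\<in>L h. label_estimate G C h l k"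
    using label_exists[OF _ contained] by metis
  have "\<forall>\<^sub>F h in small. h \<in> I \<and> h > 0 \<and> 1 * h \<le> h0" "\<forall>\<^sub>F h in small. h \<in> I \<and> h > 0 \<and> R * h \<le> r / 2"
    by (rule eventually_small_mult_le, use h0 r in simp)+
  then show ?thesis
  proof eventually_elim
    case (elim h)
    show ?case
    proof (intro ballI allI impI)
      fix q u k assume q: "q \<in> Q" and u: "norm u \<le> R" and k: "scaled h k = \<phi> q + h *\<^sub>R u"
      have "norm (h *\<^sub>R u) \<le> R * h" using u elim by (simp add: mult.commute mult_right_mono)
      then have "norm (h *\<^sub>R u) < r" using elim r(1) by linarith
      then have "scaled h k \<in> ball (\<phi> q) r" unfolding k by (simp add: dist_norm)
      then show "\<exists>l\<in>L h. label_estimate G C h l k" using h0(2) elim q unfolding U0_def by auto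
    qed
  qed
qed

text \<open>The three error sources are the linearization of \<open>g 0\<close>, the variation of \<open>h g 1\<close> over a distance \<open>R h\<close>
  (of order \<open>h\<^sup>2\<close>, as \<open>g 1\<close> is uniformly Lipschitz near \<open>\<phi> ` Q\<close>), and the remainder of the expansion.\<close>

lemma G_linearization:
  assumes "R > 0" "\<epsilon> > 0"
  shows "\<forall>\<^sub>F h in small. \<forall>q\<in>Q. \<forall>u. norm u \<le> R \<longrightarrow>
    \<phi> q + h *\<^sub>R u \<in> U \<and> norm (G h (\<phi> q + h *\<^sub>R u) - G h (\<phi> q) - h *\<^sub>R D q u) \<le> \<epsilon> * h"
proof -
  have QU: "\<phi> ` Q \<subseteq> U" using \<phi>Q_subset by auto
  have "\<epsilon> / (2 * R) > 0" using assms by simp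
  from smooth_on_uniformly_differentiable[OF smooth_g[of 0] open_U compact_\<phi>Q QU this]
  obtain d0 where d0: "d0 > 0" "\<And>x v. x \<in> \<phi> ` Q \<Longrightarrow> norm v \<le> d0 \<Longrightarrow> x + v \<in> U"
    "\<And>x v. x \<in> \<phi> ` Q \<Longrightarrow> norm v \<le> d0 \<Longrightarrow>
      norm (g 0 (x + v) - g 0 x - frechet_derivative (g 0) (at x) v) \<le> \<epsilon> / (2 * R) * norm v" by metis
  from smooth_on_uniformly_differentiable[OF smooth_g[of 1] open_U compact_\<phi>Q QU zero_less_one]
  obtain d1 where d1: "d1 > 0" "\<And>x v. x \<in> \<phi> ` Q \<Longrightarrow> norm v \<le> d1 \<Longrightarrow>
      norm (g 1 (x + v) - g 1 x - frechet_derivative (g 1) (at x) v) \<le> 1 * norm v" by metis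
  from derivative_bounded_on_compact[OF smooth_g[of 1] compact_\<phi>Q QU]
  obtain c where c: "c > 0" "\<And>x v. x \<in> \<phi> ` Q \<Longrightarrow> norm (frechet_derivative (g 1) (at x) v) \<le> c * norm v" by metis
  obtain K where K: "K > 0"
    "\<forall>\<^sub>F h in small. \<forall>x\<in>U. norm (G h x - g 0 x - h *\<^sub>R g 1 x) \<le> K * h^2"
    using G_approximation by blast
  have "\<forall>\<^sub>F h in small. h \<in> I \<and> h > 0 \<and> R * h \<le> d0" "\<forall>\<^sub>F h in small. h \<in> I \<and> h > 0 \<and> R * h \<le> d1"
    "\<forall>\<^sub>F h in small. h \<in> I \<and> h > 0 \<and> ((1 + c) * R + 2 * K) * h \<le> \<epsilon> / 2"
    by (rule eventually_small_mult_le, use d0 d1 assms in simp)+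
  with K(2) show ?thesis
  proof eventually_elim
    case (elim h)
    show ?case
    proof (intro ballI allI impI)
      fix q and u :: "real^2" assume q: "q \<in> Q" and u: "norm u \<le> R"
      define x where "x = \<phi> q"
      define v where "v = h *\<^sub>R u"
      have x: "x \<in> \<phi> ` Q" "x \<in> U" using q QU by (auto simp: x_def)
      have v: "norm v \<le> R * h" using u elim by (simp add: v_def mult.commute mult_right_mono)
      then have vd: "norm v \<le> d0" "norm v \<le> d1" using elim by linarith+
      then have xv: "x + v \<in> U" using d0(2)[OF x(1)] by blast
      have Dv: "frechet_derivative (g 0) (at x) v = h *\<^sub>R D q u"
        unfolding v_def x_def D_def[symmetric] by (rule linear_scale[OF linear_D[OF q]])
      have "norm (g 0 (x + v) - g 0 x - h *\<^sub>R D q u) \<le> \<epsilon> / (2 * R) * norm v"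
        using d0(3)[OF x(1) vd(1)] unfolding Dv .
      also have "\<dots> \<le> \<epsilon> / (2 * R) * (R * h)" using v assms by (intro mult_left_mono) auto
      also have "\<dots> = \<epsilon> / 2 * h" using assms by simp
      finally have 0: "norm (g 0 (x + v) - g 0 x - h *\<^sub>R D q u) \<le> \<epsilon> / 2 * h" .
      have "norm (g 1 (x + v) - g 1 x) \<le> norm (frechet_derivative (g 1) (at x) v)
          + norm (g 1 (x + v) - g 1 x - frechet_derivative (g 1) (at x) v)"
        by (rule norm_triangle_sub)
      also have "\<dots> \<le> (1 + c) * norm v"
        using d1(2)[OF x(1) vd(2)] c(2)[OF x(1), of v] by (simp add: algebra_simps)
      also have "\<dots> \<le> (1 + c) * (R * h)" using v c(1) by (intro mult_left_mono) auto
      finally have g1: "norm (g 1 (x + v) - g 1 x) \<le> (1 + c) * (R * h)" .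
      have 1: "norm (h *\<^sub>R (g 1 (x + v) - g 1 x)) \<le> (1 + c) * R * h * h"
        using mult_left_mono[OF g1, of h] elim unfolding norm_scaleR by (simp add: ac_simps)
      have 2: "norm (G h (x + v) - g 0 (x + v) - h *\<^sub>R g 1 (x + v)) \<le> K * h^2"
        "norm (G h x - g 0 x - h *\<^sub>R g 1 x) \<le> K * h^2"
        using elim xv x by auto
      have "G h (x + v) - G h x - h *\<^sub>R D q u = (g 0 (x + v) - g 0 x - h *\<^sub>R D q u)
        + h *\<^sub>R (g 1 (x + v) - g 1 x) + (G h (x + v) - g 0 (x + v) - h *\<^sub>R g 1 (x + v))
        - (G h x - g 0 x - h *\<^sub>R g 1 x)"
        by (simp add: algebra_simps)
      also have "norm \<dots> \<le> \<epsilon> / 2 * h + (1 + c) * R * h * h + K * h^2 + K * h^2"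
        by (rule norm_diff_mono[OF norm_triangle_mono[OF norm_triangle_mono[OF 0 1] 2(1)] 2(2)])
      also have "\<dots> = \<epsilon> / 2 * h + (((1 + c) * R + 2 * K) * h) * h"
        by (simp add: algebra_simps power2_eq_square)
      also have "\<dots> \<le> \<epsilon> / 2 * h + \<epsilon> / 2 * h"
        using elim by (intro add_left_mono mult_right_mono) auto
      finally show "\<phi> q + h *\<^sub>R u \<in> U \<and> norm (G h (\<phi> q + h *\<^sub>R u) - G h (\<phi> q) - h *\<^sub>R D q u) \<le> \<epsilon> * h"
        using xv by (simp add: x_def v_def)
    qed
  qed
qed

lemma eventually_labelling:
  "\<forall>\<^sub>F h in small. inj_on (\<kappa> h) (L h) \<and>
    (\<forall>l\<in>L h. scaled h (\<kappa> h l) \<in> U \<and> label_estimate G C h l (\<kappa> h l))"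
  using labelling by (auto intro: eventually_smallI)

lemma label_estimateD:
  assumes "label_estimate G C h l k" "h > 0"
  shows "norm (l - G h (scaled h k)) \<le> \<bar>C 1\<bar> * h" "norm (l - G h (scaled h k)) \<le> \<bar>C 2\<bar> * h * h"
proof -
  have *: "norm (l - G h (scaled h k)) \<le> C N * h ^ N" for N
    using assms unfolding label_estimate_def by blast
  have "C N * h ^ N \<le> \<bar>C N\<bar> * h ^ N" for N using assms by (intro mult_right_mono) auto
  from order_trans[OF * this] show "norm (l - G h (scaled h k)) \<le> \<bar>C 1\<bar> * h"
    "norm (l - G h (scaled h k)) \<le> \<bar>C 2\<bar> * h * h"
    by (metis power_one_right, metis mult.assoc power2_eq_square)
qed

text \<open>A label of a lattice point near \<open>q\<close> is itself near \<open>\<phi> q\<close>, wherever in \<open>U\<close> it might lie a priori: since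
  \<open>G h\<close> is uniformly close to \<open>g 0\<close> on all of \<open>U\<close>, the value of \<open>g 0\<close> there is within \<open>O(h)\<close> of \<open>q\<close>, and \<open>\<phi>\<close>
  is Lipschitz near \<open>Q\<close>.\<close>

lemma label_near:
  obtains R where "R > 0" "\<forall>\<^sub>F h in small. \<forall>q\<in>Q. \<forall>l\<in>L h. \<forall>k. scaled h k \<in> U \<longrightarrow> label_estimate G C h l k \<longrightarrow>
    dist l q \<le> \<rho> * h \<longrightarrow> (\<exists>u. norm u \<le> R \<and> scaled h k = \<phi> q + h *\<^sub>R u)"
proof -
  obtain K where K: "K > 0" "\<forall>\<^sub>F h in small. \<forall>x\<in>U. norm (G h x - g 0 x) \<le> K * h"
    using G_approximation by blast
  obtain c where c: "c > 0" "\<And>q v. q \<in> Q \<Longrightarrow> norm (frechet_derivative \<phi> (at q) v) \<le> c * norm v"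
    using derivative_bounded_on_compact[OF smooth_\<phi> Q(1) Q_V] by metis
  from smooth_on_uniformly_differentiable[OF smooth_\<phi> open_V Q(1) Q_V zero_less_one]
  obtain d where d: "d > 0" "\<And>q v. q \<in> Q \<Longrightarrow> norm v \<le> d \<Longrightarrow>
      norm (\<phi> (q + v) - \<phi> q - frechet_derivative \<phi> (at q) v) \<le> 1 * norm v" by metis
  define E where "E = \<bar>\<rho>\<bar> + \<bar>C 1\<bar> + K"
  have E: "E > 0" using K(1) by (simp add: E_def add_nonneg_pos)
  show thesis
  proof
    show "(c + 1) * E > 0" using E c(1) by simp
    have "\<forall>\<^sub>F h in small. h \<in> I \<and> h > 0 \<and> E * h \<le> d" by (rule eventually_small_mult_le[OF d(1)])
    with K(2) show "\<forall>\<^sub>F h in small. \<forall>q\<in>Q. \<forall>l\<in>L h. \<forall>k. scaled h k \<in> U \<longrightarrow> label_estimate G C h l k \<longrightarrow>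
      dist l q \<le> \<rho> * h \<longrightarrow> (\<exists>u. norm u \<le> (c + 1) * E \<and> scaled h k = \<phi> q + h *\<^sub>R u)"
    proof eventually_elim
      case (elim h)
      show ?case
      proof (intro ballI allI impI)
        fix q l k assume q: "q \<in> Q" and l: "l \<in> L h" and k: "scaled h k \<in> U" "label_estimate G C h l k"
          and lq: "dist l q \<le> \<rho> * h"
        define x where "x = scaled h k"
        define v where "v = g 0 x - q"
        have h: "h > 0" using elim by simp
        have lq': "norm (l - q) \<le> \<rho> * h" using lq by (simp add: dist_norm)
        have Gg: "norm (G h x - g 0 x) \<le> K * h" using elim(1) k(1) by (simp add: x_def)
        have "v = (l - q) - (l - G h x) - (G h x - g 0 x)" by (simp add: v_def)
        also have "norm \<dots> \<le> \<rho> * h + \<bar>C 1\<bar> * h + K * h"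
          using label_estimateD(1)[OF k(2) h]
          by (intro norm_diff_mono[OF norm_diff_mono[OF lq'] Gg]) (simp add: x_def)
        also have "\<dots> \<le> E * h"
          using mult_right_mono[of \<rho> "\<bar>\<rho>\<bar>" h] h by (simp add: E_def distrib_right)
        finally have v: "norm v \<le> E * h" .
        then have vd: "norm v \<le> d" using elim by linarith
        have "norm (\<phi> (q + v) - \<phi> q) \<le> norm (frechet_derivative \<phi> (at q) v)
          + norm (\<phi> (q + v) - \<phi> q - frechet_derivative \<phi> (at q) v)"
          by (rule norm_triangle_sub)
        also have "\<dots> \<le> (c + 1) * norm v"
          using d(2)[OF q vd] c(2)[OF q, of v] by (simp add: algebra_simps)
        also have "\<dots> \<le> (c + 1) * (E * h)" using v c(1) by (intro mult_left_mono) auto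
        finally have "norm (x - \<phi> q) \<le> (c + 1) * E * h" using k(1) by (simp add: v_def x_def)
        then have "norm ((1 / h) *\<^sub>R (x - \<phi> q)) \<le> (c + 1) * E"
          using h unfolding norm_scaleR by (simp add: field_simps)
        moreover have "scaled h k = \<phi> q + h *\<^sub>R ((1 / h) *\<^sub>R (x - \<phi> q))" using h by (simp add: x_def)
        ultimately show "\<exists>u. norm u \<le> (c + 1) * E \<and> scaled h k = \<phi> q + h *\<^sub>R u" by blast
      qed
    qed
  qed
qed

text \<open>This places the origin \<open>\<lambda>\<^sub>0\<^sub>,\<^sub>0\<close> of the algorithm within \<open>O(h)\<close> of \<open>c\<close>.\<close>

lemma lattice_meets_small_balls:
  obtains R where "R > 0" "\<forall>\<^sub>F h in small. \<forall>q\<in>Q. \<exists>l\<in>L h. dist l q \<le> R * h"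
proof -
  obtain K where K: "K > 0" "\<forall>\<^sub>F h in small. \<forall>x\<in>U. norm (G h x - g 0 x) \<le> K * h"
    using G_approximation by blast
  obtain m' where m': "m' > 0" "\<And>q v. q \<in> Q \<Longrightarrow> norm (D q v) \<le> m' * norm v"
    using D_bounds by metis
  define R where "R = \<bar>C 1\<bar> + 1 + m' + K"
  have "R > 0" using m' K(1) by (simp add: R_def)
  moreover have "\<forall>\<^sub>F h in small. \<forall>q\<in>Q. \<exists>l\<in>L h. dist l q \<le> R * h"
    using eventually_small_mult_le[OF zero_less_one, of 1] label_existence_near_Q[of 1] K(2)
      G_linearization[of 1 1, OF zero_less_one zero_less_one]
  proof eventually_elim
    case (elim h)
    show ?case
    proof
      fix q assume q: "q \<in> Q"
      have h: "h > 0" using elim by simp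
      obtain k where k: "norm (scaled h k - \<phi> q) \<le> h" using exists_int_point_near[OF h] .
      define u where "u = (1 / h) *\<^sub>R (scaled h k - \<phi> q)"
      have u: "norm u \<le> 1" "scaled h k = \<phi> q + h *\<^sub>R u" using k h by (simp_all add: u_def)
      then obtain l where l: "l \<in> L h" "label_estimate G C h l k" using elim q by blast
      have "\<phi> q \<in> U" "g 0 (\<phi> q) = q" using q Q_V \<phi>_mem by auto
      then have 1: "norm (G h (\<phi> q) - q) \<le> K * h" using elim(3) by metis
      have 2: "norm (G h (scaled h k) - G h (\<phi> q) - h *\<^sub>R D q u) \<le> 1 * h"
        using elim(4) q u(1) unfolding u(2) by blast
      have "norm (D q u) \<le> m' * 1"
        using m'(2)[OF q, of u] mult_left_mono[OF u(1), of m'] m'(1) by linarith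
      then have 3: "norm (h *\<^sub>R D q u) \<le> m' * h" using h by (simp add: mult.commute)
      have "l - q = (l - G h (scaled h k)) + (G h (scaled h k) - G h (\<phi> q) - h *\<^sub>R D q u)
          + h *\<^sub>R D q u + (G h (\<phi> q) - q)" by simp
      also have "norm \<dots> \<le> \<bar>C 1\<bar> * h + 1 * h + m' * h + K * h"
        by (rule norm_triangle_mono[OF norm_triangle_mono[OF norm_triangle_mono[OF
              label_estimateD(1)[OF l(2) h] 2] 3] 1])
      also have "\<dots> = R * h" by (simp add: R_def algebra_simps)
      finally show "\<exists>l\<in>L h. dist l q \<le> R * h" using l(1) by (auto simp: dist_norm)
    qed
  qed
  ultimately show thesis using that by blast
qed

text \<open>Stated for arbitrary labels satisfying the estimate, not just those chosen by the labelling; the case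
  \<open>l = l'\<close> then shows that labels are unique.\<close>

lemma label_difference:
  assumes "\<epsilon> > 0"
  shows "\<forall>\<^sub>F h in small. \<forall>q\<in>Q. \<forall>l\<in>L h. \<forall>l'\<in>L h. \<forall>k k'.
    scaled h k \<in> U \<longrightarrow> label_estimate G C h l k \<longrightarrow> scaled h k' \<in> U \<longrightarrow> label_estimate G C h l' k' \<longrightarrow>
    dist l q \<le> \<rho> * h \<longrightarrow> dist l' q \<le> \<rho> * h \<longrightarrow>
    norm (l' - l - h *\<^sub>R D q (int_point (k' - k))) \<le> \<epsilon> * h"
proof -
  obtain R where R: "R > 0" "\<forall>\<^sub>F h in small. \<forall>q\<in>Q. \<forall>l\<in>L h. \<forall>k. scaled h k \<in> U \<longrightarrow>
    label_estimate G C h l k \<longrightarrow> dist l q \<le> \<rho> * h \<longrightarrow> (\<exists>u. norm u \<le> R \<and> scaled h k = \<phi> q + h *\<^sub>R u)"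
    using label_near .
  have "\<epsilon> / 4 > 0" using assms by simp
  from R(2) G_linearization[OF R(1) this] eventually_small_mult_le[OF this, of "\<bar>C 2\<bar>"]
  show ?thesis
  proof eventually_elim
    case (elim h)
    show ?case
    proof (intro ballI allI impI)
      fix q l l' k k'
      assume q: "q \<in> Q" and l: "l \<in> L h" "l' \<in> L h" "dist l q \<le> \<rho> * h" "dist l' q \<le> \<rho> * h"
        and k: "scaled h k \<in> U" "label_estimate G C h l k"
        and k': "scaled h k' \<in> U" "label_estimate G C h l' k'"
      have h: "h > 0" and C2: "\<bar>C 2\<bar> * h \<le> \<epsilon> / 4" using elim by auto
      obtain u where u: "norm u \<le> R" "scaled h k = \<phi> q + h *\<^sub>R u" using elim(1) q l k by blast
      obtain u' where u': "norm u' \<le> R" "scaled h k' = \<phi> q + h *\<^sub>R u'" using elim(1) q l k' by blast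
      have "h *\<^sub>R int_point (k' - k) = h *\<^sub>R (u' - u)"
        using u(2) u'(2) by (simp add: scaled_int_point int_point_diff algebra_simps)
      then have uu: "int_point (k' - k) = u' - u" using h by simp
      have lin: "norm (G h (scaled h k) - G h (\<phi> q) - h *\<^sub>R D q u) \<le> \<epsilon> / 4 * h"
        "norm (G h (scaled h k') - G h (\<phi> q) - h *\<^sub>R D q u') \<le> \<epsilon> / 4 * h"
        using elim(2) q u(1) u'(1) unfolding u(2) u'(2) by blast+
      have err: "norm (l - G h (scaled h k)) \<le> \<epsilon> / 4 * h" "norm (l' - G h (scaled h k')) \<le> \<epsilon> / 4 * h"
        using label_estimateD(2)[OF k(2) h] label_estimateD(2)[OF k'(2) h]
          mult_right_mono[OF C2, of h] h by linarith+
      have "l' - l - h *\<^sub>R D q (int_point (k' - k)) = (l' - G h (scaled h k'))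
          + (G h (scaled h k') - G h (\<phi> q) - h *\<^sub>R D q u') - (l - G h (scaled h k))
          - (G h (scaled h k) - G h (\<phi> q) - h *\<^sub>R D q u)"
        unfolding uu linear_diff[OF linear_D[OF q]] by (simp add: algebra_simps)
      also have "norm \<dots> \<le> \<epsilon> / 4 * h + \<epsilon> / 4 * h + \<epsilon> / 4 * h + \<epsilon> / 4 * h"
        by (rule norm_diff_mono[OF norm_diff_mono[OF norm_triangle_mono[OF err(2) lin(2)] err(1)] lin(1)])
      finally show "norm (l' - l - h *\<^sub>R D q (int_point (k' - k))) \<le> \<epsilon> * h" by simp
    qed
  qed
qed

text \<open>The crude bound \<open>\<rho>'\<close> on the distance brings the new point into the range of \<open>label_difference\<close>, which
  then gives its position up to \<open>\<epsilon> h\<close>.\<close>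

lemma label_realised_near:
  assumes "\<rho> > 0"
  obtains \<rho>' where "\<forall>\<^sub>F h in small. \<forall>q\<in>Q. \<forall>l\<in>L h. \<forall>k z. scaled h k \<in> U \<longrightarrow>
    label_estimate G C h l k \<longrightarrow> dist l q \<le> \<rho> * h \<longrightarrow> norm (int_point z) \<le> \<rho> \<longrightarrow>
    scaled h (k + z) \<in> U \<and> (\<exists>l'\<in>L h. label_estimate G C h l' (k + z) \<and> dist l' q \<le> \<rho>' * h)"
proof -
  obtain R where R: "R > 0" "\<forall>\<^sub>F h in small. \<forall>q\<in>Q. \<forall>l\<in>L h. \<forall>k. scaled h k \<in> U \<longrightarrow>
    label_estimate G C h l k \<longrightarrow> dist l q \<le> \<rho> * h \<longrightarrow> (\<exists>u. norm u \<le> R \<and> scaled h k = \<phi> q + h *\<^sub>R u)"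
    using label_near .
  obtain m' where m': "m' > 0" "\<And>q v. q \<in> Q \<Longrightarrow> norm (D q v) \<le> m' * norm v"
    using D_bounds by metis
  define \<rho>' where "\<rho>' = 2 * \<bar>C 1\<bar> + 2 + m' * \<rho> + \<rho>"
  have pos: "R + \<rho> > 0" using R assms by simp
  show thesis
  proof
    show "\<forall>\<^sub>F h in small. \<forall>q\<in>Q. \<forall>l\<in>L h. \<forall>k z. scaled h k \<in> U \<longrightarrow>
      label_estimate G C h l k \<longrightarrow> dist l q \<le> \<rho> * h \<longrightarrow> norm (int_point z) \<le> \<rho> \<longrightarrow>
      scaled h (k + z) \<in> U \<and> (\<exists>l'\<in>L h. label_estimate G C h l' (k + z) \<and> dist l' q \<le> \<rho>' * h)"
      using R(2) G_linearization[OF pos zero_less_one] label_existence_near_Q[of "R + \<rho>"]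
        eventually_small_mult_le[OF zero_less_one, of 1]
    proof eventually_elim
      case (elim h)
      show ?case
      proof (intro ballI allI impI)
        fix q l k and z :: "int^2"
        assume q: "q \<in> Q" and l: "l \<in> L h" "dist l q \<le> \<rho> * h"
          and k: "scaled h k \<in> U" "label_estimate G C h l k" and z: "norm (int_point z) \<le> \<rho>"
        have h: "h > 0" using elim by simp
        obtain u where u: "norm u \<le> R" "scaled h k = \<phi> q + h *\<^sub>R u" using elim(1) q l k by blast
        define u' where "u' = u + int_point z"
        have u': "norm u' \<le> R + \<rho>" "scaled h (k + z) = \<phi> q + h *\<^sub>R u'"
          using u z norm_triangle_mono[OF u(1) z]
          by (simp_all add: u'_def scaled_int_point int_point_add algebra_simps)
        have lq: "norm (l - q) \<le> \<rho> * h" using l(2) by (simp add: dist_norm)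
        have u_le: "norm u \<le> R + \<rho>" using u(1) assms by simp
        have kz: "scaled h (k + z) \<in> U" using elim(2) q u'(1) unfolding u'(2) by blast
        obtain l' where l': "l' \<in> L h" "label_estimate G C h l' (k + z)"
          using elim(3) q u' by blast
        have lin: "norm (G h (scaled h k) - G h (\<phi> q) - h *\<^sub>R D q u) \<le> 1 * h"
          "norm (G h (scaled h (k + z)) - G h (\<phi> q) - h *\<^sub>R D q u') \<le> 1 * h"
          using elim(2) q u_le u'(1) unfolding u(2) u'(2) by blast+
        have "norm (D q (int_point z)) \<le> m' * \<rho>"
          using m'(2)[OF q, of "int_point z"] mult_left_mono[OF z, of m'] m'(1) by linarith
        then have Dz: "norm (h *\<^sub>R D q (int_point z)) \<le> m' * \<rho> * h" using h by (simp add: mult.commute)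
        have split: "l' - q = (l' - G h (scaled h (k + z)))
            + (G h (scaled h (k + z)) - G h (\<phi> q) - h *\<^sub>R D q u') + h *\<^sub>R D q (int_point z) + (l - q)
            - (l - G h (scaled h k)) - (G h (scaled h k) - G h (\<phi> q) - h *\<^sub>R D q u)"
          unfolding u'_def linear_add[OF linear_D[OF q]] by (simp add: algebra_simps)
        have "norm (l' - q) \<le> \<bar>C 1\<bar> * h + 1 * h + m' * \<rho> * h + \<rho> * h + \<bar>C 1\<bar> * h + 1 * h"
          unfolding split by (rule norm_diff_mono[OF norm_diff_mono[OF norm_triangle_mono[OF norm_triangle_mono[OF
                norm_triangle_mono[OF label_estimateD(1)[OF l'(2) h] lin(2)] Dz] lq]
                label_estimateD(1)[OF k(2) h]] lin(1)])
        also have "\<dots> = \<rho>' * h" by (simp add: \<rho>'_def algebra_simps)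
        finally show "scaled h (k + z) \<in> U \<and>
            (\<exists>l'\<in>L h. label_estimate G C h l' (k + z) \<and> dist l' q \<le> \<rho>' * h)"
          using kz l' by (auto simp: dist_norm)
      qed
    qed
  qed
qed

text \<open>The chart yields a lattice point with an estimate for the label \<open>k + z\<close>. That the labelling assigns
  this very label to it follows from uniqueness: two labels of one point differ by \<open>w\<close> with
  \<open>|D q w| \<le> m / 2\<close>, whereas \<open>|D q w| \<ge> m\<close> for nonzero integer \<open>w\<close>.\<close>

lemma eventually_locally_affine:
  assumes "\<rho> > 0" "\<epsilon> > 0"
  shows "\<forall>\<^sub>F h in small. \<forall>q\<in>Q. locally_affine (L h) (\<kappa> h) (D q) h \<rho> \<epsilon> q"
proof -
  obtain m where m: "m > 0" "\<And>q v. q \<in> Q \<Longrightarrow> m * norm v \<le> norm (D q v)" using D_bounds by metis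
  obtain \<rho>' where \<rho>': "\<forall>\<^sub>F h in small. \<forall>q\<in>Q. \<forall>l\<in>L h. \<forall>k z. scaled h k \<in> U \<longrightarrow>
    label_estimate G C h l k \<longrightarrow> dist l q \<le> \<rho> * h \<longrightarrow> norm (int_point z) \<le> \<rho> \<longrightarrow>
    scaled h (k + z) \<in> U \<and> (\<exists>l'\<in>L h. label_estimate G C h l' (k + z) \<and> dist l' q \<le> \<rho>' * h)"
    using label_realised_near[OF assms(1)] .
  have "m / 2 > 0" using m by simp
  show ?thesis
    using eventually_labelling \<rho>' label_difference[OF assms(2), of "max \<rho> \<rho>'"]
      label_difference[OF \<open>m / 2 > 0\<close>, of "max \<rho> \<rho>'"] eventually_small_mult_le[OF zero_less_one, of 1]
  proof eventually_elim
    case (elim h)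
    have h: "h > 0" using elim by simp
    have label: "scaled h (\<kappa> h l) \<in> U" "label_estimate G C h l (\<kappa> h l)" if "l \<in> L h" for l
      using elim(1) that by auto
    have mono: "x \<le> max \<rho> \<rho>' * h" if "x \<le> \<rho> * h \<or> x \<le> \<rho>' * h" for x
    proof -
      have "\<rho> * h \<le> max \<rho> \<rho>' * h" "\<rho>' * h \<le> max \<rho> \<rho>' * h" using h by (auto intro: mult_right_mono)
      then show ?thesis using that by linarith
    qed
    show ?case
      unfolding locally_affine_def
    proof (intro ballI conjI allI impI)
      fix q l l' assume "q \<in> Q" "l \<in> L h" "l' \<in> L h" "dist l q \<le> \<rho> * h" "dist l' q \<le> \<rho> * h"
      then show "norm (l' - l - h *\<^sub>R D q (int_point (\<kappa> h l' - \<kappa> h l))) \<le> \<epsilon> * h"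
        using elim(3) label mono by blast
    next
      fix q l and z :: "int^2" assume q: "q \<in> Q" and l: "l \<in> L h" "dist l q \<le> \<rho> * h" and z: "norm (int_point z) \<le> \<rho>"
      define k where "k = \<kappa> h l + z"
      obtain l' where k: "scaled h k \<in> U" and l': "l' \<in> L h" "label_estimate G C h l' k" "dist l' q \<le> \<rho>' * h"
        using elim(2) q l z label unfolding k_def by blast
      have "norm (l' - l' - h *\<^sub>R D q (int_point (\<kappa> h l' - k))) \<le> m / 2 * h"
        using elim(4) q k l' label mono by blast
      then have "norm (D q (int_point (\<kappa> h l' - k))) \<le> m / 2" using h by (simp add: mult.commute)
      then have "m * norm (int_point (\<kappa> h l' - k)) \<le> m * (1 / 2)"
        using m(2)[OF q, of "int_point (\<kappa> h l' - k)"] by linarith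
      then have "\<kappa> h l' = k" using norm_int_point_ge_1[of "\<kappa> h l' - k"] m(1) by force
      moreover have "norm (l' - l - h *\<^sub>R D q (int_point (k - \<kappa> h l))) \<le> \<epsilon> * h"
        using elim(3) q l k l' label mono by blast
      ultimately show "\<exists>l'\<in>L h. \<kappa> h l' = \<kappa> h l + z \<and> norm (l' - l - h *\<^sub>R D q (int_point z)) \<le> \<epsilon> * h"
        using l'(1) unfolding k_def by auto
    qed
  qed
qed

end

text \<open>The points labelled \<open>\<kappa> l \<plusminus> z\<close> lie within \<open>\<epsilon> h\<close> of \<open>l \<plusminus> h D z\<close>, so reflecting the one in \<open>l\<close> lands within
  \<open>2 \<epsilon> h\<close> of the other. A second lattice point as close as that would be within \<open>4 \<epsilon> h\<close> of the first, but two
  lattice points this close to \<open>l\<close> are at least \<open>(m - \<epsilon>) h\<close> apart.\<close>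

lemma locally_affine_extrapolation:
  fixes S :: "(real^2) set" and D :: "real^2 \<Rightarrow> real^2"
  assumes D: "linear D" "\<And>v. m * norm v \<le> norm (D v)" and h: "h > 0" and \<epsilon>: "5 * \<epsilon> < m"
    and m: "m > 0"
    and affine: "locally_affine S \<kappa> D h \<rho> \<epsilon> l" and inj: "inj_on \<kappa> S"
    and l: "l \<in> S" "l1 \<in> S" "\<kappa> l1 = \<kappa> l - z"
    and z: "norm (int_point z) \<le> \<rho>" "norm (D (int_point z)) + 3 * \<epsilon> \<le> \<rho>" and "\<epsilon> > 0"
  shows "\<exists>l2\<in>S. \<kappa> l2 = \<kappa> l + z \<and>
    (\<forall>l'\<in>S. l' \<noteq> l2 \<longrightarrow> dist l2 (l + (l - l1)) < dist l' (l + (l - l1)))"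
proof -
  define a where "a = h *\<^sub>R D (int_point z)"
  define x where "x = l + (l - l1)"
  have "norm (int_point z) \<ge> 0" by simp
  then have \<rho>: "\<rho> \<ge> 0" using z(1) by linarith
  have ll: "dist l l \<le> \<rho> * h" using \<rho> h by simp
  obtain l2 where l2: "l2 \<in> S" "\<kappa> l2 = \<kappa> l + z" "norm (l2 - l - a) \<le> \<epsilon> * h"
    using affine l(1) ll z(1) unfolding locally_affine_def a_def by blast
  have mz: "norm (int_point (- z)) \<le> \<rho>" "h *\<^sub>R D (int_point (- z)) = - a"
    using z(1) by (simp_all add: int_point_minus a_def linear_neg[OF D(1)])
  then obtain l1' where l1': "l1' \<in> S" "\<kappa> l1' = \<kappa> l + - z" "norm (l1' - l - - a) \<le> \<epsilon> * h"
    using affine l(1) ll unfolding locally_affine_def by metis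
  then have "l1' = l1" using inj_onD[OF inj _ l1'(1) l(2)] l1'(2) l(3) by simp
  then have l1: "norm (l1 - l + a) \<le> \<epsilon> * h" using l1' by simp
  have a_\<rho>: "norm a + 3 * \<epsilon> * h \<le> \<rho> * h"
    using mult_right_mono[OF z(2), of h] h by (simp add: a_def algebra_simps)
  have split: "l2 - x = (l2 - l - a) + (l1 - l + a)" by (simp add: x_def)
  have "norm (l2 - x) \<le> \<epsilon> * h + \<epsilon> * h"
    unfolding split by (rule norm_triangle_mono[OF l2(3) l1])
  then have l2x: "norm (l2 - x) \<le> 2 * \<epsilon> * h" by linarith
  have "dist l2 x < dist l' x" if l': "l' \<in> S" "l' \<noteq> l2" for l'
  proof (rule ccontr)
    assume "\<not> dist l2 x < dist l' x"
    then have l'x: "norm (l' - x) \<le> 2 * \<epsilon> * h" using l2x by (simp add: dist_norm)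
    have split': "l' - l = (l' - x) - (l1 - l + a) + a" by (simp add: x_def)
    have "norm (l' - l) \<le> 2 * \<epsilon> * h + \<epsilon> * h + norm a"
      unfolding split' by (rule norm_triangle_mono[OF norm_diff_mono[OF l'x l1] order_refl])
    then have l'\<rho>: "dist l' l \<le> \<rho> * h" using a_\<rho> unfolding dist_norm by linarith
    have "norm (l2 - l - a + a) \<le> \<epsilon> * h + norm a"
      by (rule norm_triangle_mono[OF l2(3) order_refl])
    then have "norm (l2 - l) \<le> \<epsilon> * h + norm a" by simp
    moreover have "\<epsilon> * h > 0" using \<open>\<epsilon> > 0\<close> h by simp
    ultimately have l2\<rho>: "dist l2 l \<le> \<rho> * h" using a_\<rho> unfolding dist_norm by linarith
    define w where "w = \<kappa> l' - \<kappa> l2"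
    have "norm (l' - l2 - h *\<^sub>R D (int_point w)) \<le> \<epsilon> * h"
      using affine l' l2(1) l'\<rho> l2\<rho> unfolding locally_affine_def w_def by blast
    from norm_diff_mono[OF norm_diff_mono[OF l'x l2x] this]
    have "norm (h *\<^sub>R D (int_point w)) \<le> 5 * \<epsilon> * h" by simp
    then have "norm (D (int_point w)) \<le> 5 * \<epsilon>" using h by (simp add: mult.commute)
    then have "m * norm (int_point w) < m * 1" using D(2)[of "int_point w"] \<epsilon> by simp
    then have "norm (int_point w) < 1" using m by (simp del: mult_1_right)
    then have "w = 0" using norm_int_point_ge_1[of w] by fastforce
    then show False using l' l2(1) inj by (simp add: w_def inj_on_eq_iff)
  qed
  then show ?thesis using l2 unfolding x_def by blast
qed


section \<open>The labelling algorithm at a fixed scale\<close>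

lemma closest_unlabelled_eqI:
  assumes "closest_unlabelled S A x q" "l \<in> S" "l \<notin> A"
    and "\<And>l'. l' \<in> S \<Longrightarrow> l' \<noteq> l \<Longrightarrow> dist l x < dist l' x"
  shows "q = l"
  using assms unfolding closest_unlabelled_def is_arg_min_def by blast

lemma closest_unlabelled_mem: "closest_unlabelled S A x q \<Longrightarrow> q \<in> S \<and> q \<notin> A"
  by (simp add: closest_unlabelled_def is_arg_min_def)

lemma closest_unlabelled_le:
  "closest_unlabelled S A x q \<Longrightarrow> l \<in> S \<Longrightarrow> l \<notin> A \<Longrightarrow> dist q x \<le> dist l x"
  by (auto simp: closest_unlabelled_def is_arg_min_linorder)

lemma scale_int_vec_eq_iff:
  fixes z :: "int^'n" assumes "z \<noteq> 0" shows "m *s z = n *s z \<longleftrightarrow> m = n"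
  using assms by (auto simp: vec_eq_iff)

text \<open>What the combinatorial argument uses about the lattice for one fixed small \<open>h\<close>. Lengths of integer
  vectors are measured through \<open>M\<close>. The radius \<open>r\<close> bounds the lengths of the standard basis vectors, so the
  relevant minimal vectors have length at most \<open>r\<close>; lengths up to \<open>r + 1\<close> must be visible to leave
  room for the errors. The assumption \<open>gap\<close> says that no two different lengths in that range are within \<open>2 \<epsilon>\<close>
  of each other, and \<open>continues\<close> that extrapolating an arithmetic progression of labels inside \<open>B0\<close> by one
  step singles out the next label.\<close>

locale affine_picture =
  fixes S B0 :: "(real^2) set" and \<kappa> :: "real^2 \<Rightarrow> int^2" and p0 :: "real^2"
    and M :: "real^2 \<Rightarrow> real^2" and h \<epsilon> r :: real
  assumes h: "h > 0" and \<epsilon>: "\<epsilon> > 0" "\<epsilon> \<le> 1/4"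
    and inj: "inj_on \<kappa> S"
    and M: "linear M" "\<And>v. v \<noteq> 0 \<Longrightarrow> M v \<noteq> 0"
    and p0: "p0 \<in> S"
    and r: "norm (M (int_point (axis i 1))) \<le> r"
    and exists_near: "norm (M (int_point w)) \<le> r + 1 \<Longrightarrow>
      \<exists>l\<in>S. \<kappa> l = \<kappa> p0 + w \<and> norm (l - p0 - h *\<^sub>R M (int_point w)) \<le> \<epsilon> * h"
    and affine_near: "l \<in> S \<Longrightarrow> dist l p0 \<le> (r + 1) * h \<Longrightarrow>
      norm (l - p0 - h *\<^sub>R M (int_point (\<kappa> l - \<kappa> p0))) \<le> \<epsilon> * h"
    and gap: "norm (M (int_point v)) \<le> r + 1 \<Longrightarrow> norm (M (int_point w)) \<le> r + 1 \<Longrightarrow>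
      norm (M (int_point v)) \<le> norm (M (int_point w)) + 2 * \<epsilon> \<Longrightarrow>
      norm (M (int_point v)) \<le> norm (M (int_point w))"
    and ball: "cball p0 ((r + 2) * h) \<subseteq> B0"
    and continues: "l \<in> S \<Longrightarrow> l \<in> B0 \<Longrightarrow> l1 \<in> S \<Longrightarrow> \<kappa> l1 = \<kappa> l - z \<Longrightarrow> norm (M (int_point z)) \<le> r + 1 \<Longrightarrow>
      \<exists>l2\<in>S. \<kappa> l2 = \<kappa> l + z \<and> (\<forall>l'\<in>S. l' \<noteq> l2 \<longrightarrow> dist l2 (l + (l - l1)) < dist l' (l + (l - l1)))"
begin

abbreviation len :: "int^2 \<Rightarrow> real" where "len w \<equiv> norm (M (int_point w))"

lemma len_scale: "len (n *s w) = \<bar>real_of_int n\<bar> * len w"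
  by (simp add: int_point_scale linear_scale[OF M(1)])

lemma exists_near_dist:
  assumes "len w \<le> r + 1"
  obtains l where "l \<in> S" "\<kappa> l = \<kappa> p0 + w" "dist l p0 \<le> (len w + \<epsilon>) * h"
proof -
  obtain l where l: "l \<in> S" "\<kappa> l = \<kappa> p0 + w" "norm (l - p0 - h *\<^sub>R M (int_point w)) \<le> \<epsilon> * h"
    using exists_near[OF assms] by blast
  have "norm (l - p0) \<le> norm (h *\<^sub>R M (int_point w)) + norm (l - p0 - h *\<^sub>R M (int_point w))"
    by (rule norm_triangle_sub)
  then have "dist l p0 \<le> (len w + \<epsilon>) * h"
    using l(3) h by (simp add: dist_norm algebra_simps)
  with l that show thesis by blast
qed

lemma label_near_mem_B0:
  assumes "l \<in> S" "len (\<kappa> l - \<kappa> p0) \<le> r + 1"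
  shows "l \<in> B0"
proof -
  obtain l' where l': "l' \<in> S" "\<kappa> l' = \<kappa> p0 + (\<kappa> l - \<kappa> p0)" "dist l' p0 \<le> (len (\<kappa> l - \<kappa> p0) + \<epsilon>) * h"
    using exists_near_dist[OF assms(2)] .
  then have "l' = l" using inj assms(1) by (simp add: inj_on_eq_iff)
  moreover have "(len (\<kappa> l - \<kappa> p0) + \<epsilon>) * h \<le> (r + 2) * h"
    using assms(2) \<epsilon> h by (intro mult_right_mono) auto
  ultimately show ?thesis using l'(3) ball by (auto simp: dist_commute)
qed

text \<open>Distances from \<open>p0\<close> are \<open>h\<close> times lengths up to \<open>\<epsilon> h\<close>, so the label step to a closest point outside \<open>A\<close> is
  within \<open>2 \<epsilon>\<close> of minimal, and then exactly minimal by the gap. Here \<open>W\<close> is a set of steps that avoid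
  \<open>A\<close>; the step to \<open>q\<close> itself may lie outside \<open>W\<close>.\<close>

lemma closest_label_shortest:
  assumes q: "closest_unlabelled S A p0 q"
    and W: "\<And>w l. w \<in> W \<Longrightarrow> l \<in> S \<Longrightarrow> \<kappa> l = \<kappa> p0 + w \<Longrightarrow> l \<notin> A"
    and e: "e \<in> W" "len e \<le> r"
  shows "len (\<kappa> q - \<kappa> p0) \<le> r + 1" "\<And>w. w \<in> W \<Longrightarrow> len (\<kappa> q - \<kappa> p0) \<le> len w"
proof -
  have upper: "dist q p0 \<le> (len w + \<epsilon>) * h" if w: "w \<in> W" "len w \<le> r + 1" for w
  proof -
    obtain l where "l \<in> S" "\<kappa> l = \<kappa> p0 + w" "dist l p0 \<le> (len w + \<epsilon>) * h"
      using exists_near_dist[OF w(2)] .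
    then show ?thesis using closest_unlabelled_le[OF q] W[OF w(1)] by fastforce
  qed
  have "dist q p0 \<le> (len e + \<epsilon>) * h" using upper[OF e(1)] e(2) by simp
  also have "\<dots> \<le> (r + 1) * h" using e(2) \<epsilon> h by (intro mult_right_mono) auto
  finally have *: "norm (q - p0 - h *\<^sub>R M (int_point (\<kappa> q - \<kappa> p0))) \<le> \<epsilon> * h"
    using affine_near closest_unlabelled_mem[OF q] by blast
  have lower: "len (\<kappa> q - \<kappa> p0) \<le> len w + 2 * \<epsilon>" if "w \<in> W" "len w \<le> r + 1" for w
  proof -
    have "norm (h *\<^sub>R M (int_point (\<kappa> q - \<kappa> p0)))
        \<le> norm (q - p0) + norm (q - p0 - h *\<^sub>R M (int_point (\<kappa> q - \<kappa> p0)))"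
      by (metis norm_triangle_sub norm_minus_commute)
    then have "h * len (\<kappa> q - \<kappa> p0) \<le> h * (len w + 2 * \<epsilon>)"
      using * upper[OF that] h by (simp add: dist_norm algebra_simps)
    then show ?thesis using h by simp
  qed
  show le: "len (\<kappa> q - \<kappa> p0) \<le> r + 1" using lower[OF e(1)] e(2) \<epsilon> by simp
  show "len (\<kappa> q - \<kappa> p0) \<le> len w" if "w \<in> W" for w
    using gap[OF le _ lower[OF that]] le by (cases "len w \<le> r + 1") auto
qed

lemma next_label:
  assumes q: "closest_unlabelled S A (l + (l - l1)) q"
    and l: "l \<in> S" "l \<in> B0" "l1 \<in> S" "\<kappa> l1 = \<kappa> l - z" and z: "len z \<le> r + 1"
    and A: "\<And>x. x \<in> A \<Longrightarrow> \<kappa> x \<noteq> \<kappa> l + z"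
  shows "\<kappa> q = \<kappa> l + z"
proof -
  obtain l2 where "l2 \<in> S" "\<kappa> l2 = \<kappa> l + z"
    "\<And>l'. l' \<in> S \<Longrightarrow> l' \<noteq> l2 \<Longrightarrow> dist l2 (l + (l - l1)) < dist l' (l + (l - l1))"
    using continues[OF l z] by blast
  then show ?thesis using closest_unlabelled_eqI[OF q] A by metis
qed

text \<open>The whole chain has labels \<open>\<kappa> p0 + n z\<close>, so the steps that are not multiples of \<open>z\<close> are all available
  when \<open>p01\<close> is chosen. Conversely the chain has exhausted all multiples of \<open>z\<close> of length at most \<open>r + 1\<close>,
  because its two ends stopped outside \<open>B0\<close>; so \<open>p01\<close> is not reached by a multiple of \<open>z\<close>.\<close>

lemma labelling_run_gives_basis:
  assumes run: "labelling_run S B0 c p a b p01" and "p 0 = p0"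
  shows "int_basis_pair (\<kappa> (p 1) - \<kappa> p0) (\<kappa> p01 - \<kappa> p0)"
proof -
  define z where "z = \<kappa> (p 1) - \<kappa> p0"
  define good where "good n \<longleftrightarrow> p n \<in> S \<and> p n \<in> B0 \<and> \<kappa> (p n) = \<kappa> p0 + n *s z" for n
  have a: "a \<ge> 1" and b: "b \<ge> 1" and c1: "closest_unlabelled S {p0} p0 (p 1)"
    and c01: "closest_unlabelled S (p ` {-b..a}) p0 p01"
    and up: "\<And>n. n \<in> {2..a} \<Longrightarrow> closest_unlabelled S (p ` {0..n-1}) (p (n-1) + (p (n-1) - p (n-2))) (p n) \<and> p n \<in> B0"
    and cm1: "closest_unlabelled S (p ` {0..a}) (2 *\<^sub>R p0 - p 1) (p (-1))"
    and down: "\<And>n. n \<in> {-b..-2} \<Longrightarrow> closest_unlabelled S (p ` {n+1..a}) (p (n+1) + (p (n+1) - p (n+2))) (p n) \<and> p n \<in> B0"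
    using run unfolding labelling_run_def \<open>p 0 = p0\<close> by auto
  obtain qa where qa: "closest_unlabelled S (p ` {0..a}) (p a + (p a - p (a-1))) qa" "qa \<notin> B0"
    using run unfolding labelling_run_def by auto
  obtain qb where qb: "closest_unlabelled S (p ` {-b..a}) (p (-b) + (p (-b) - p (-b+1))) qb" "qb \<notin> B0"
    using run unfolding labelling_run_def by auto

  have ax: "axis i 1 \<noteq> (0 :: int^2)" for i by (simp add: axis_eq_0_iff)
  have shortest: "len z \<le> r + 1" "\<And>w. w \<noteq> 0 \<Longrightarrow> len z \<le> len w"
  proof -
    have "l \<notin> {p0}" if "w \<in> - {0}" "\<kappa> l = \<kappa> p0 + w" for w l using that by auto
    note * = closest_label_shortest[OF c1, of "- {0}", OF this _ r]
    have i: "axis i 1 \<in> - {0 :: int^2}" for i using ax by simp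
    show "len z \<le> r + 1" unfolding z_def by (rule *(1)[OF _ _ i])
    show "len z \<le> len w" if "w \<noteq> 0" for w unfolding z_def by (rule *(2)[OF _ _ i]) (use that in auto)
  qed
  have p1: "p 1 \<in> S" "p 1 \<noteq> p0" using closest_unlabelled_mem[OF c1] by auto
  have z0: "z \<noteq> 0" using inj p1 p0 unfolding z_def inj_on_def by auto
  note z_inj = scale_int_vec_eq_iff[OF z0]
  have minus_z: "len (- z) = len z" by (simp add: int_point_minus linear_neg[OF M(1)])

  have shift: "(n - 1) *s z = n *s z - z" "(n - 2) *s z = n *s z - z - z"
    "(n + 1) *s z = n *s z + z" "(n + 2) *s z = n *s z + z + z" for n
    by (simp_all add: vec_eq_iff algebra_simps)
  have up_step: "\<kappa> q = \<kappa> p0 + n *s z"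
    if q: "closest_unlabelled S (p ` J) (p (n-1) + (p (n-1) - p (n-2))) q"
      and g: "good (n-1)" "good (n-2)" and J: "\<And>j. j \<in> J \<Longrightarrow> good j \<and> j \<noteq> n" for n q J
  proof -
    have n: "\<kappa> (p (n-1)) + z = \<kappa> p0 + n *s z" using g(1) by (simp add: good_def shift)
    have "\<kappa> x \<noteq> \<kappa> (p (n-1)) + z" if "x \<in> p ` J" for x
      using that J z_inj unfolding n good_def by auto
    moreover have "\<kappa> (p (n-2)) = \<kappa> (p (n-1)) - z" using g unfolding good_def shift by (simp only: add_diff_eq)
    ultimately have "\<kappa> q = \<kappa> (p (n-1)) + z"
      using g shortest(1) by (intro next_label[OF q]) (auto simp: good_def)
    then show ?thesis using n by simp
  qed
  have down_step: "\<kappa> q = \<kappa> p0 + n *s z"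
    if q: "closest_unlabelled S (p ` J) (p (n+1) + (p (n+1) - p (n+2))) q"
      and g: "good (n+1)" "good (n+2)" and J: "\<And>j. j \<in> J \<Longrightarrow> good j \<and> j \<noteq> n" for n q J
  proof -
    have n: "\<kappa> (p (n+1)) + (- z) = \<kappa> p0 + n *s z" using g(1) by (simp add: good_def shift)
    have "\<kappa> x \<noteq> \<kappa> (p (n+1)) + (- z)" if "x \<in> p ` J" for x
      using that J z_inj unfolding n good_def by auto
    moreover have "\<kappa> (p (n+2)) = \<kappa> (p (n+1)) - (- z)" using g unfolding good_def shift by (simp only: add.assoc diff_minus_eq_add)
    ultimately have "\<kappa> q = \<kappa> (p (n+1)) + (- z)"
      using g shortest(1) minus_z by (intro next_label[OF q]) (auto simp: good_def)
    then show ?thesis using n by simp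
  qed

  have "0 \<le> r" using r[of 1] norm_ge_zero order_trans by blast
  then have good0: "good 0" using p0 label_near_mem_B0[of p0] \<open>p 0 = p0\<close>
    unfolding good_def by (simp add: linear_0[OF M(1)])
  have good1: "good 1" using p1 shortest(1) label_near_mem_B0[of "p 1"] by (simp add: good_def z_def)
  have good_up: "\<forall>j\<in>{0..int m}. good j" if "int m \<le> a" for m
    using that
  proof (induction m)
    case 0 then show ?case using good0 by simp
  next
    case (Suc m)
    then have IH: "\<forall>j\<in>{0..int m}. good j" by simp
    have "good (int (Suc m))"
    proof (cases "m = 0")
      case True then show ?thesis using good1 by simp
    next
      case False
      then have n: "int (Suc m) \<in> {2..a}" using Suc.prems by auto
      have "\<kappa> (p (int (Suc m))) = \<kappa> p0 + int (Suc m) *s z"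
        using IH False by (intro up_step[of "{0..int (Suc m) - 1}"] conjunct1[OF up[OF n]]) auto
      then show ?thesis unfolding good_def
        using up[OF n] closest_unlabelled_mem by blast
    qed
    moreover have "{0..int (Suc m)} = insert (int (Suc m)) {0..int m}" by auto
    ultimately show ?case using IH by simp
  qed
  have good_nonneg: "good j" if "j \<in> {0..a}" for j using good_up[of "nat a"] that by auto

  have good_m1: "good (-1)"
  proof -
    have "\<kappa> (p (-1)) = \<kappa> p0 + (-1) *s z"
      using cm1 good_nonneg good0 good1 \<open>p 0 = p0\<close>
      by (intro down_step[of "{0..a}"]) (auto simp: scaleR_2)
    moreover from this have "p (-1) \<in> B0"
      using label_near_mem_B0[of "p (-1)"] closest_unlabelled_mem[OF cm1] shortest(1) minus_z by simp
    ultimately show ?thesis using closest_unlabelled_mem[OF cm1] by (simp add: good_def)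
  qed
  have good_down: "\<forall>j\<in>{- int m..a}. good j" if "int m \<le> b" for m
    using that
  proof (induction m)
    case 0 then show ?case using good_nonneg by simp
  next
    case (Suc m)
    then have IH: "\<forall>j\<in>{- int m..a}. good j" by simp
    have "good (- int (Suc m))"
    proof (cases "m = 0")
      case True then show ?thesis using good_m1 by simp
    next
      case False
      then have n: "- int (Suc m) \<in> {-b..-2}" using Suc.prems by auto
      have "\<kappa> (p (- int (Suc m))) = \<kappa> p0 + (- int (Suc m)) *s z"
        using IH False a by (intro down_step[of "{- int (Suc m) + 1..a}"] conjunct1[OF down[OF n]]) auto
      then show ?thesis unfolding good_def
        using down[OF n] closest_unlabelled_mem by blast
    qed
    moreover have "{- int (Suc m)..a} = insert (- int (Suc m)) {- int m..a}" using a by auto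
    ultimately show ?case using IH by simp
  qed
  have good: "good j" if "j \<in> {-b..a}" for j using good_down[of "nat b"] that b by auto

  \<comment> \<open>The discarded points \<open>qa\<close> and \<open>qb\<close> carry the next labels on the line; being outside
    \<open>B0\<close>, they are far from \<open>p0\<close>.\<close>
  have "\<kappa> qa = \<kappa> p0 + (a + 1) *s z"
    using qa(1) good a b by (intro up_step[of "{0..a}"]) auto
  then have far_a: "len ((a + 1) *s z) > r + 1"
    using label_near_mem_B0[of qa] qa closest_unlabelled_mem by force
  have "\<kappa> qb = \<kappa> p0 + (- b - 1) *s z"
    using qb(1) good a b by (intro down_step[of "{-b..a}"]) auto
  then have far_b: "len ((- b - 1) *s z) > r + 1"
    using label_near_mem_B0[of qb] qb closest_unlabelled_mem by force
  have labelled: "m \<in> {-b..a}" if "len (m *s z) \<le> r + 1" for m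
  proof (rule ccontr)
    assume "m \<notin> {-b..a}"
    then have "m \<ge> a + 1 \<or> m \<le> - b - 1" by auto
    then have "\<bar>real_of_int (a + 1)\<bar> \<le> \<bar>real_of_int m\<bar> \<or> \<bar>real_of_int (- b - 1)\<bar> \<le> \<bar>real_of_int m\<bar>"
      using a b by linarith
    then have "len ((a + 1) *s z) \<le> len (m *s z) \<or> len ((- b - 1) *s z) \<le> len (m *s z)"
      unfolding len_scale by (meson mult_right_mono norm_ge_zero)
    then show False using far_a far_b that by linarith
  qed

  \<comment> \<open>One of the two standard basis vectors is a competitor for the second step.\<close>
  obtain i where i: "axis i 1 \<notin> range (\<lambda>n. n *s z)"
  proof (rule ccontr)
    assume "\<not> thesis"
    then have "axis 1 1 \<in> range (\<lambda>n. n *s z)" "axis 2 1 \<in> range (\<lambda>n. n *s z)" using that by blast+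
    then obtain m n where "axis 1 1 = m *s z" "axis 2 1 = n *s z" by blast
    then have "axis 1 1 $ j = m * z $ j" "axis 2 1 $ j = n * z $ j" for j by simp_all
    from this(1)[of 1] this(1)[of 2] this(2)[of 2] show False by (auto simp: axis_def)
  qed
  have unlabelled: "l \<notin> p ` {-b..a}" if "w \<in> - range (\<lambda>n. n *s z)" "\<kappa> l = \<kappa> p0 + w" for w l
    using that good by (auto simp: good_def)
  have z2: "len (\<kappa> p01 - \<kappa> p0) \<le> r + 1"
    "\<And>w. w \<notin> range (\<lambda>n. n *s z) \<Longrightarrow> len (\<kappa> p01 - \<kappa> p0) \<le> len w"
    using closest_label_shortest[OF c01, of "- range (\<lambda>n. n *s z)", OF unlabelled _ r] i by auto
  have "\<kappa> p01 - \<kappa> p0 \<notin> range (\<lambda>n. n *s z)"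
  proof
    assume "\<kappa> p01 - \<kappa> p0 \<in> range (\<lambda>n. n *s z)"
    then obtain m where m: "\<kappa> p01 - \<kappa> p0 = m *s z" by blast
    then have "m \<in> {-b..a}" using labelled z2(1) by simp
    moreover from this have "\<kappa> p01 = \<kappa> (p m)" "p m \<in> S" using good m by (auto simp: good_def algebra_simps)
    ultimately show False using closest_unlabelled_mem[OF c01] inj by (metis image_eqI inj_on_eq_iff)
  qed
  then show ?thesis
    using reduced_pair_is_basis[OF M z0 shortest(2) _ z2(2)] unfolding z_def by blast
qed
end

section \<open>Small scales\<close>

lemma finite_set_gap:
  fixes X :: "real set" assumes "finite X"
  obtains \<gamma> where "\<gamma> > 0" "\<And>x y. x \<in> X \<Longrightarrow> y \<in> X \<Longrightarrow> x < y \<Longrightarrow> \<gamma> \<le> y - x"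
proof -
  define Y where "Y = {d \<in> (\<lambda>(x, y). y - x) ` (X \<times> X). d > 0}"
  have Y: "finite Y" using assms by (simp add: Y_def)
  have pos: "Min (insert 1 Y) > 0" using Y by (subst Min_gr_iff) (auto simp: Y_def)
  show thesis
  proof
    show "Min (insert 1 Y) > 0" by fact
    show "Min (insert 1 Y) \<le> y - x" if "x \<in> X" "y \<in> X" "x < y" for x y
      using that Y by (intro Min_le) (force simp: Y_def)+
  qed
qed

lemma norm_int_point_axis [simp]: "norm (int_point (axis i 1)) = 1"
proof -
  have "int_point (axis i 1) = axis i 1" by (simp add: vec_eq_iff axis_def)
  then show ?thesis by simp
qed

theorem theorem3p44:
  fixes L :: "real \<Rightarrow> (real^2) set" and I :: "real set" and B B0 :: "(real^2) set"
    and k :: "real \<Rightarrow> real^2 \<Rightarrow> int^2" and c :: "real^2"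
  assumes "asymptotic_lattice L I B"
    and "good_labelling L I B k"
    and "open B0" and "compactly_contained B0 B" and "c \<in> B0"
  shows "\<exists>h4>0. \<forall>h\<in>I. h \<le> h4 \<longrightarrow>
    (\<forall>p00 p10 p01. labelling_output (L h) B0 c p00 p10 p01 \<longrightarrow>
       (let z1 = k h p10 - k h p00; z2 = k h p01 - k h p00 in int_basis_pair z1 z2))"
proof -
  obtain G U C where chart: "asymptotic_chart L I B G U C"
    and lab: "\<exists>h0>0. \<forall>h\<in>I. h \<le> h0 \<longrightarrow> inj_on (k h) (L h) \<and>
           (\<forall>l\<in>L h. scaled h (k h l) \<in> U \<and> label_estimate G C h l (k h l))"
    using assms(2) unfolding good_labelling_def by blast
  obtain g V where g: "smooth_expansion I U G g" "oriented_diffeomorphism U V (g 0)" "closure B \<subseteq> V"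
    "\<forall>U0. open U0 \<and> compactly_contained U0 {x\<in>U. g 0 x \<in> B} \<longrightarrow>
           (\<exists>h0>0. \<forall>h\<in>I. h \<le> h0 \<longrightarrow>
              (\<forall>k. scaled h k \<in> U0 \<longrightarrow> (\<exists>l\<in>L h. label_estimate G C h l k)))"
    using chart unfolding asymptotic_chart_def by blast
  have "I \<subseteq> {0<..}" "open B" using assms(1) unfolding asymptotic_lattice_def by auto
  moreover have "compact (closure B0)" "closure B0 \<subseteq> B"
    using assms(4) unfolding compactly_contained_def by auto
  ultimately interpret charted_lattice L I B "closure B0" U V k G g C
    using g lab by unfold_locales blast+
  have in_Q: "q \<in> closure B0" if "q \<in> B0" for q using that closure_subset by blast
  note cQ = in_Q[OF assms(5)]

  obtain m r where m: "m > 0" "\<And>q v. q \<in> closure B0 \<Longrightarrow> m * norm v \<le> norm (D q v)"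
    and r: "r > 0" "\<And>q v. q \<in> closure B0 \<Longrightarrow> norm (D q v) \<le> r * norm v"
    using D_bounds by metis
  obtain R where R: "R > 0" "\<forall>\<^sub>F h in small. \<forall>q\<in>closure B0. \<exists>l\<in>L h. dist l q \<le> R * h"
    using lattice_meets_small_balls .
  define M where "M = D c"
  define len where "len w = norm (M (int_point w))" for w
  define s where "s = (r + 1) / m"
  have s: "s > 0" using r m by (simp add: s_def)
  have short: "norm (int_point w) \<le> s" if "len w \<le> r + 1" for w
  proof -
    have "m * norm (int_point w) \<le> r + 1"
      using that m(2)[OF cQ, of "int_point w"] by (simp add: len_def M_def)
    then show ?thesis using m(1) by (simp add: s_def field_simps)
  qed
  have "finite {w. len w \<le> r + 1}"
    using short by (intro finite_subset[OF _ finite_int_points_bounded[of s]] subsetI CollectI) simp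
  then obtain \<gamma> where \<gamma>: "\<gamma> > 0"
    "\<And>x y. x \<in> len ` {w. len w \<le> r + 1} \<Longrightarrow> y \<in> len ` {w. len w \<le> r + 1} \<Longrightarrow> x < y \<Longrightarrow> \<gamma> \<le> y - x"
    using finite_set_gap[OF finite_imageI] by metis
  define \<epsilon> where "\<epsilon> = min (1/4) (min (\<gamma> / 3) (m / 6))"
  have \<epsilon>: "\<epsilon> > 0" "\<epsilon> \<le> 1/4" "2 * \<epsilon> < \<gamma>" "5 * \<epsilon> < m"
    using \<gamma>(1) m(1) by (auto simp: \<epsilon>_def min_def)
  \<comment> \<open>Large enough for steps of length \<open>r + 1\<close> (norm at most \<open>s\<close>) from points
    within \<open>R h\<close> of \<open>c\<close>, and for the extrapolation along the chain, where such a step is measured by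
    another \<open>D q\<close>.\<close>
  define \<rho> where "\<rho> = R + (r + 1) + s + r * s"
  have \<rho>: "R \<le> \<rho>" "R + (r + 1) \<le> \<rho>" "s \<le> \<rho>" "r * s + 1 \<le> \<rho>" "\<rho> > 0"
    using R(1) r(1) s mult_pos_pos[OF r(1) s] unfolding \<rho>_def by linarith+
  obtain e where e: "e > 0" "ball c e \<subseteq> B0" using assms(3,5) openE by blast

  have "\<forall>\<^sub>F h in small. \<forall>p00 p10 p01. labelling_output (L h) B0 c p00 p10 p01 \<longrightarrow>
    int_basis_pair (k h p10 - k h p00) (k h p01 - k h p00)"
    using R(2) eventually_labelling eventually_locally_affine[OF \<rho>(5) \<epsilon>(1)]
      eventually_small_mult_le[OF half_gt_zero[OF e(1)], of "R + (r + 2)"]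
  proof eventually_elim
    case (elim h)
    then have h: "h > 0" and inj: "inj_on (k h) (L h)" and small_h: "(R + (r + 2)) * h < e"
      and affine: "\<And>q. q \<in> closure B0 \<Longrightarrow> locally_affine (L h) (k h) (D q) h \<rho> \<epsilon> q"
      using e(1) by auto
    have \<rho>h: "x * h \<le> \<rho> * h" if "x \<le> \<rho>" for x using that h by (intro mult_right_mono) auto
    show ?case
    proof (intro allI impI)
      fix p00 p10 p01 assume "labelling_output (L h) B0 c p00 p10 p01"
      then obtain p a b where run: "labelling_run (L h) B0 c p a b p01" and p: "p00 = p 0" "p10 = p 1"
        unfolding labelling_output_def by blast
      then have p0: "closest_unlabelled (L h) {} c (p 0)" unfolding labelling_run_def by blast
      then have p0_mem: "p 0 \<in> L h" using closest_unlabelled_mem by blast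
      obtain l0 where "l0 \<in> L h" "dist l0 c \<le> R * h" using elim(1) cQ by blast
      then have p0_c: "dist (p 0) c \<le> R * h" using closest_unlabelled_le[OF p0] by force
      interpret affine_picture "L h" B0 "k h" "p 0" M h \<epsilon> r
      proof
        show "h > 0" "\<epsilon> > 0" "\<epsilon> \<le> 1/4" "inj_on (k h) (L h)" "p 0 \<in> L h" by fact+
        show "M (v + w) = M v + M w" for v w unfolding M_def by (rule linear_add[OF linear_D[OF cQ]])
        show "M (x *\<^sub>R v) = x *\<^sub>R M v" for x v unfolding M_def by (rule linear_scale[OF linear_D[OF cQ]])
        show "M v \<noteq> 0" if "v \<noteq> 0" for v
          using m(2)[OF cQ, of v] mult_pos_pos[OF m(1), of "norm v"] that unfolding M_def by auto
        show "norm (M (int_point (axis i 1))) \<le> r" for i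
          using r(2)[OF cQ, of "int_point (axis i 1)"] unfolding M_def by simp
        show "\<exists>l\<in>L h. k h l = k h (p 0) + w \<and> norm (l - p 0 - h *\<^sub>R M (int_point w)) \<le> \<epsilon> * h"
          if "norm (M (int_point w)) \<le> r + 1" for w
        proof -
          have "norm (int_point w) \<le> \<rho>" using short[of w] that \<rho>(3) unfolding len_def by linarith
          moreover have "dist (p 0) c \<le> \<rho> * h" using p0_c \<rho>h[OF \<rho>(1)] by linarith
          ultimately show ?thesis
            using affine[OF cQ] p0_mem unfolding locally_affine_def M_def by blast
        qed
        show "norm (l - p 0 - h *\<^sub>R M (int_point (k h l - k h (p 0)))) \<le> \<epsilon> * h"
          if "l \<in> L h" "dist l (p 0) \<le> (r + 1) * h" for l
        proof -
          have "dist l c \<le> (R + (r + 1)) * h"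
            using dist_triangle[of l c "p 0"] that(2) p0_c by (simp add: algebra_simps)
          then have "dist l c \<le> \<rho> * h" using \<rho>h[OF \<rho>(2)] by linarith
          moreover have "dist (p 0) c \<le> \<rho> * h" using p0_c \<rho>h[OF \<rho>(1)] by linarith
          ultimately show ?thesis
            using affine[OF cQ] p0_mem that(1) unfolding locally_affine_def M_def by blast
        qed
        show "norm (M (int_point v)) \<le> norm (M (int_point w))"
          if "norm (M (int_point v)) \<le> r + 1" "norm (M (int_point w)) \<le> r + 1"
            "norm (M (int_point v)) \<le> norm (M (int_point w)) + 2 * \<epsilon>" for v w
          using \<gamma>(2)[of "len w" "len v"] that \<epsilon>(3) unfolding len_def by force
        show "cball (p 0) ((r + 2) * h) \<subseteq> B0"
        proof
          fix y assume "y \<in> cball (p 0) ((r + 2) * h)"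
          then have "dist c y \<le> (R + (r + 2)) * h"
            using dist_triangle[of c y "p 0"] p0_c by (simp add: algebra_simps dist_commute)
          then show "y \<in> B0" using small_h e(2) by (auto simp: subset_iff)
        qed
        show "\<exists>l2\<in>L h. k h l2 = k h l + z \<and>
            (\<forall>l'\<in>L h. l' \<noteq> l2 \<longrightarrow> dist l2 (l + (l - l1)) < dist l' (l + (l - l1)))"
          if l: "l \<in> L h" "l \<in> B0" "l1 \<in> L h" "k h l1 = k h l - z"
            and z: "norm (M (int_point z)) \<le> r + 1" for l l1 z
        proof (rule locally_affine_extrapolation[where m = m and D = "D l" and h = h])
          have zs: "norm (int_point z) \<le> s" using short[of z] z unfolding len_def .
          then show "norm (int_point z) \<le> \<rho>" using \<rho>(3) by linarith
          have "norm (D l (int_point z)) \<le> r * s"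
            using r(2)[OF in_Q[OF l(2)], of "int_point z"] mult_left_mono[OF zs, of r] r(1) by linarith
          then show "norm (D l (int_point z)) + 3 * \<epsilon> \<le> \<rho>" using \<rho>(4) \<epsilon>(2) by linarith
        qed (use l h inj m \<epsilon> affine linear_D in_Q in auto)
      qed
      show "int_basis_pair (k h p10 - k h p00) (k h p01 - k h p00)"
        unfolding p by (rule labelling_run_gives_basis[OF run refl])
    qed
  qed
  then obtain d where "d > 0" "\<And>h. h \<in> I \<Longrightarrow> h \<noteq> 0 \<Longrightarrow> dist h 0 < d \<Longrightarrow>
    \<forall>p00 p10 p01. labelling_output (L h) B0 c p00 p10 p01 \<longrightarrow>
    int_basis_pair (k h p10 - k h p00) (k h p01 - k h p00)"
    unfolding eventually_at by blast
  then show ?thesis using I_pos unfolding Let_def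
    by (intro exI[of _ "d / 2"]) (auto simp: dist_real_def subset_iff)
qed

end
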